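(* Let $G$ be an amenable locally compact group, $K$ a compact subgroup of $G$, $U\subset G$ a closed $K$-bi-invariant symmetric neighbourhood of the identity $e\in G$ having finite Haar measure, and $V\subset G$ a closed $K$-bi-invariant symmetric subset of $G$. Then there exists an extremal function for the Delsarte constant $\mathcal{C}_{G/K}(U,V)$; that is, there exists $\Phi\in\mathcal{F}_{G/K}(U,V)$ with $$\int_{G/K}\Phi(K,yK)\,d\mu(yK)=\mathcal{C}_{G/K}(U,V).$$
   Context: $\lambda_G$ is a (left) Haar measure on $G$; $\lambda_K$ is the Haar measure on $K$ with $\lambda_K(K)=1$; $\mu$ is the $G$-invariant Radon measure on $G/K$ normalised by $\int_G f\,d\lambda_G=\int_{G/K}\int_K f(gk)\,d\lambda_K(k)\,d\mu(gK)$ for all $f\in C_c(G)$. A subset $A\subset G$ is $K$-bi-invariant if $KAK=A$, and symmetric if $A^{-1}=A$. A kernel on $G/K$ is a function $\Phi:G/K\times G/K\to\mathbb{C}$; it is $G$-invariant if $\Phi(gxK,gyK)=\Phi(xK,yK)$ for all $g,x,y\in G$, and positive definite if $\sum_{i,j=1}^n\Phi(x_iK,x_jK)a_i\overline{a_j}\ge0$ for all $n\in\mathbb{N}$, $a_i\in\mathbb{C}$, $x_i\in G$. For a real-valued kernel, $\Phi_+=\max\{\Phi,0\}$ and $\Phi_-=\max\{-\Phi,0\}$. For a $G$-invariant kernel $\Phi$, $\operatorname{supp}\Phi:=\overline{\{x\in G:\Phi(K,xK)\neq 0\}}\subset G$. $\mathcal{F}_{G/K}(U,V)$ is the set of continuous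 positive definite $G$-invariant kernels $\Phi:G/K\times G/K\to\mathbb{R}$ with $\Phi(gK,gK)=1$ for all $g\in G$, $\operatorname{supp}\Phi_+\subset U$ and $\operatorname{supp}\Phi_-\subset V$, and $$\mathcal{C}_{G/K}(U,V):=\sup_{\Phi\in\mathcal{F}_{G/K}(U,V)}\int_{G/K}\Phi(xK,yK)\,d\mu(yK),$$ where $x\in G$ is arbitrary (the integral does not depend on $x$). Integrals are taken in the extended sense (a member of the class whose negative part has infinite integral and whose positive part has finite integral has integral $-\infty$). *)

theory Defs
  imports "HOL-Analysis.Analysis" "HOL-Library.Set_Algebras" "HOL-Library.Nonpos_Ints"
begin

text \<open>
  Topological groups are types of class \<^class>\<open>topological_group_add\<close>. This class is written
  additively but is not commutative: the product \<open>x y\<close> is \<open>x + y\<close>, the inverse of \<open>x\<close> is \<open>- x\<close>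
  and the identity is \<open>0\<close>. The left coset \<open>x K\<close> is \<open>x +o K\<close>, and \<open>K A K\<close> is \<open>K + A + K\<close>.
\<close>

definition is_subgroup :: "'g::group_add set \<Rightarrow> bool" where
  "is_subgroup K \<longleftrightarrow> 0 \<in> K \<and> (\<forall>x\<in>K. \<forall>y\<in>K. x + y \<in> K) \<and> (\<forall>x\<in>K. - x \<in> K)"

definition bi_invariant :: "'g::group_add set \<Rightarrow> 'g set \<Rightarrow> bool" where
  "bi_invariant K A \<longleftrightarrow> K + A + K = A"

definition symmetric_set :: "'g::group_add set \<Rightarrow> bool" where
  "symmetric_set A \<longleftrightarrow> uminus ` A = A"

definition cosets :: "'g::group_add set \<Rightarrow> 'g set set" where
  "cosets K = range (\<lambda>x. x +o K)"

definition coset_topology :: "'g::topological_group_add set \<Rightarrow> 'g set topology" where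
  "coset_topology K = topology (\<lambda>S. S \<subseteq> cosets K \<and> open ((\<lambda>x. x +o K) -` S))"

lemma openin_coset_topology:
  "openin (coset_topology K) S \<longleftrightarrow> S \<subseteq> cosets K \<and> open ((\<lambda>x. x +o K) -` S)"
proof -
  have "istopology (\<lambda>S. S \<subseteq> cosets K \<and> open ((\<lambda>x. x +o K) -` S))"
    unfolding istopology_def by (auto simp: vimage_Union intro: open_Int open_UN)
  then show ?thesis
    by (simp add: coset_topology_def topology_inverse')
qed

lemma topspace_coset_topology: "topspace (coset_topology K) = cosets K"
proof -
  have "(\<lambda>x. x +o K) -` cosets K = UNIV"
    by (auto simp: cosets_def)
  then have "openin (coset_topology K) (cosets K)"
    by (simp add: openin_coset_topology)
  then show ?thesis
    by (meson openin_coset_topology openin_subset openin_topspace subset_antisym)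
qed

lemma quotient_map_coset_topology:
  "quotient_map euclidean (coset_topology K) (\<lambda>x. x +o K)"
  by (auto simp: quotient_map_def topspace_coset_topology openin_coset_topology vimage_def
      cosets_def)

definition borel_of_topology :: "'a topology \<Rightarrow> 'a measure" where
  "borel_of_topology X = sigma (topspace X) {S. openin X S}"

lemma borel_of_topology_euclidean: "borel_of_topology euclidean = borel"
  by (simp add: borel_of_topology_def borel_def)

text \<open>
  Outer regularity is required of all Borel sets but inner regularity only of open ones;
  the two conventions differ when the space is not \<open>\<sigma>\<close>-compact.
\<close>

definition radon_measure :: "'a topology \<Rightarrow> 'a measure \<Rightarrow> bool" where
  "radon_measure X M \<longleftrightarrow>
     space M = topspace X \<and> sets M = sets (borel_of_topology X) \<and>
     (\<forall>C. compactin X C \<longrightarrow> emeasure M C < \<infinity>) \<and>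
     (\<forall>A\<in>sets M. emeasure M A = (INF S\<in>{S. openin X S \<and> A \<subseteq> S}. emeasure M S)) \<and>
     (\<forall>S. openin X S \<longrightarrow> emeasure M S = (SUP C\<in>{C. compactin X C \<and> C \<subseteq> S}. emeasure M C))"

definition left_haar_measure :: "'g::topological_group_add set \<Rightarrow> 'g measure \<Rightarrow> bool" where
  "left_haar_measure H M \<longleftrightarrow>
     radon_measure (top_of_set H) M \<and> emeasure M H \<noteq> 0 \<and>
     (\<forall>h\<in>H. \<forall>A\<in>sets M. emeasure M (h +o A) = emeasure M A)"

text \<open>
  \<open>f\<close> below ranges over \<open>C\<^sub>c(G)\<close>. The inner integral does not depend on the representative
  of the coset \<open>p\<close>, because \<open>lamK\<close> is invariant.
\<close>

definition normalised_quotient_measure ::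
    "'g::topological_group_add set \<Rightarrow> 'g measure \<Rightarrow> 'g measure \<Rightarrow> 'g set measure \<Rightarrow> bool" where
  "normalised_quotient_measure K lamG lamK mu \<longleftrightarrow>
     radon_measure (coset_topology K) mu \<and>
     (\<forall>g. \<forall>A\<in>sets mu. emeasure mu ((\<lambda>p. g +o p) ` A) = emeasure mu A) \<and>
     (\<forall>f :: 'g \<Rightarrow> real. continuous_on UNIV f \<longrightarrow> compact (closure {x. f x \<noteq> 0}) \<longrightarrow>
        (\<integral>x. f x \<partial>lamG) = (\<integral>p. (\<integral>k. f ((SOME g. g \<in> p) + k) \<partial>lamK) \<partial>mu))"

text \<open>
  Amenability: a left invariant mean on \<open>L\<^sup>\<infinity>(G)\<close>. As usual for groups that need not be
  \<open>\<sigma>\<close>-compact, functions are identified when they agree locally almost everywhere.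
\<close>

definition locally_null :: "'g::topological_space measure \<Rightarrow> 'g set \<Rightarrow> bool" where
  "locally_null M N \<longleftrightarrow> N \<in> sets M \<and> (\<forall>C. compact C \<longrightarrow> emeasure M (N \<inter> C) = 0)"

definition bounded_borel :: "('g::topological_space \<Rightarrow> real) set" where
  "bounded_borel = {f. f \<in> borel_measurable borel \<and> bounded (range f)}"

definition amenable :: "'g::topological_group_add measure \<Rightarrow> bool" where
  "amenable lamG \<longleftrightarrow>
     (\<exists>m :: ('g \<Rightarrow> real) \<Rightarrow> real.
        (\<forall>f\<in>bounded_borel. \<forall>g\<in>bounded_borel. m (\<lambda>x. f x + g x) = m f + m g) \<and>
        (\<forall>c. \<forall>f\<in>bounded_borel. m (\<lambda>x. c * f x) = c * m f) \<and>
        (\<forall>f\<in>bounded_borel. \<forall>g\<in>bounded_borel.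
           locally_null lamG {x. f x \<noteq> g x} \<longrightarrow> m f = m g) \<and>
        (\<forall>f\<in>bounded_borel. (\<forall>x. 0 \<le> f x) \<longrightarrow> 0 \<le> m f) \<and>
        m (\<lambda>x. 1) = 1 \<and>
        (\<forall>a. \<forall>f\<in>bounded_borel. m (\<lambda>x. f (a + x)) = m f))"

text \<open>
  A kernel on \<open>G/K\<close> is a function of two sets; only its values on cosets of \<open>K\<close> matter.
\<close>

definition continuous_kernel ::
    "'g::topological_group_add set \<Rightarrow> ('g set \<Rightarrow> 'g set \<Rightarrow> real) \<Rightarrow> bool" where
  "continuous_kernel K \<Phi> \<longleftrightarrow>
     continuous_map (prod_topology (coset_topology K) (coset_topology K)) euclideanreal
       (\<lambda>(p, q). \<Phi> p q)"

definition invariant_kernel ::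
    "'g::group_add set \<Rightarrow> ('g set \<Rightarrow> 'g set \<Rightarrow> 'b) \<Rightarrow> bool" where
  "invariant_kernel K \<Phi> \<longleftrightarrow>
     (\<forall>g x y. \<Phi> ((g + x) +o K) ((g + y) +o K) = \<Phi> (x +o K) (y +o K))"

definition positive_definite_kernel ::
    "'g::group_add set \<Rightarrow> ('g set \<Rightarrow> 'g set \<Rightarrow> complex) \<Rightarrow> bool" where
  "positive_definite_kernel K \<Phi> \<longleftrightarrow>
     (\<forall>(n::nat) (x :: nat \<Rightarrow> 'g) (a :: nat \<Rightarrow> complex).
        (\<Sum>i<n. \<Sum>j<n. \<Phi> (x i +o K) (x j +o K) * a i * cnj (a j)) \<in> \<real>\<^sub>\<ge>\<^sub>0)"

definition kernel_support ::
    "'g::topological_group_add set \<Rightarrow> ('g set \<Rightarrow> 'g set \<Rightarrow> real) \<Rightarrow> 'g set" where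
  "kernel_support K \<Phi> = closure {x. \<Phi> K (x +o K) \<noteq> 0}"

definition delsarte_class ::
    "'g::topological_group_add set \<Rightarrow> 'g set \<Rightarrow> 'g set \<Rightarrow> ('g set \<Rightarrow> 'g set \<Rightarrow> real) set" where
  "delsarte_class K U V =
     {\<Phi>. continuous_kernel K \<Phi> \<and>
          positive_definite_kernel K (\<lambda>p q. complex_of_real (\<Phi> p q)) \<and>
          invariant_kernel K \<Phi> \<and>
          (\<forall>g. \<Phi> (g +o K) (g +o K) = 1) \<and>
          kernel_support K (\<lambda>p q. max (\<Phi> p q) 0) \<subseteq> U \<and>
          kernel_support K (\<lambda>p q. max (- \<Phi> p q) 0) \<subseteq> V}"

text \<open>
  Integral with values in the extended reals, meaningful when the positive or the negative
  part of \<open>f\<close> has finite integral. For a member of the class above the positive part does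
  whenever \<open>U\<close> has finite Haar measure: it is bounded by \<open>1\<close> and lives on the image of \<open>U\<close>
  in \<open>G/K\<close>. So the value \<open>\<infinity> - \<infinity>\<close> of \<^typ>\<open>ereal\<close> does not occur there.
\<close>

definition extended_integral :: "'a measure \<Rightarrow> ('a \<Rightarrow> real) \<Rightarrow> ereal" where
  "extended_integral M f =
     enn2ereal (\<integral>\<^sup>+x. ennreal (f x) \<partial>M) - enn2ereal (\<integral>\<^sup>+x. ennreal (- f x) \<partial>M)"

text \<open>
  The first argument of \<open>\<Phi>\<close> is fixed to the coset \<open>K\<close> of the identity. By invariance of \<open>\<Phi>\<close>
  and \<open>mu\<close> any other coset gives the same integral.
\<close>

definition delsarte_constant ::
    "'g::topological_group_add set measure \<Rightarrow> 'g set \<Rightarrow> 'g set \<Rightarrow> 'g set \<Rightarrow> ereal" where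
  "delsarte_constant mu K U V =
     (SUP \<Phi>\<in>delsarte_class K U V. extended_integral mu (\<lambda>q. \<Phi> K q))"

end

(*
  An invariant kernel is a function f of -x + y, right invariant under K; let nu be the pull-back
  of mu to G. In L^2(nu), sets of almost maximising functions f are convex and, by the
  parallelogram law, their elements of almost minimal norm are close to each other. This gives a
  maximising sequence that converges almost everywhere; a pointwise cluster point of it is positive
  definite, has the right signs and, by Fatou's lemma, an integral that is large enough, but it need
  not be continuous. The same convexity argument in the Hilbert space of this function,
  applied to averages of its translates over small neighbourhoods of 0, replaces it by a continuous
  positive definite function h. Translation moves the interior of U only a little in measure, so
  the integral does not decrease. Finally 0 < h 0 <= 1, because the supremum is positive, and
  h / h 0 is extremal.
*)

theory Submission
  imports Defs
begin


section \<open>Positive definite functions\<close>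

text \<open>Positive definiteness is a condition on every finite set of points, which almost
  everywhere convergence does not see, while only a measurable limit has an integral. Hence one
  sequence is given two limits, one at every point and one almost everywhere, that agree off a null
  set. The negative parts need not have a common integrable bound, so limits of integrals are always
  taken for the indicator of \<open>interior U\<close> minus the function. The interior suffices
  because a continuous function is positive on an open set. Averages are finite convex combinations
  of translates: the cluster point cannot be integrated if it is not measurable, but an identity
  almost everywhere survives finitely many translations. The normalisation of \<open>mu\<close>
  speaks only of compactly supported continuous functions on the group; finiteness, positivity and
  continuity of translation for its pull-back are therefore derived from test functions, compact
  sets of cosets and inner regularity on open sets.\<close>

text \<open>\<open>q\<close> plays a squared norm, \<open>d\<close> a squared distance,
  \<open>F\<close> a family of convex sets; \<open>m\<close> is the supremum over \<open>F\<close>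
  of the infima of \<open>q\<close>. If the infimum over \<open>A\<close> exceeds
  \<open>m - e\<close>, so does \<open>q\<close> at a midpoint of two points of \<open>A\<close>;
  when both have \<open>q\<close> below \<open>m + e\<close>, the parallelogram law
  \<open>mid\<close> bounds \<open>d x y / 4\<close> by \<open>2 * e\<close>.\<close>

lemma near_minimal:
  fixes q :: "'a \<Rightarrow> real" and d :: "'a \<Rightarrow> 'a \<Rightarrow> real" and F :: "'a set set"
  assumes "F \<noteq> {}"
    and nonneg: "\<And>A x. A \<in> F \<Longrightarrow> x \<in> A \<Longrightarrow> 0 \<le> q x"
    and bound: "\<And>A. A \<in> F \<Longrightarrow> \<exists>x\<in>A. q x \<le> B"
    and mid: "\<And>A x y. A \<in> F \<Longrightarrow> x \<in> A \<Longrightarrow> y \<in> A \<Longrightarrow> \<exists>z\<in>A. q z \<le> (q x + q y) / 2 - d x y / 4"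
  obtains m where "\<And>A e. A \<in> F \<Longrightarrow> e > 0 \<Longrightarrow> \<exists>x\<in>A. q x < m + e"
    and "\<And>e. e > 0 \<Longrightarrow> \<exists>A\<in>F. \<forall>x\<in>A. \<forall>y\<in>A. q x < m + e \<longrightarrow> q y < m + e \<longrightarrow> d x y \<le> 8 * e"
proof
  define I where "I A = (INF x\<in>A. q x)" for A
  define m where "m = (SUP A\<in>F. I A)"
  have bb: "bdd_below (q ` A)" if "A \<in> F" for A
    using nonneg[OF that] by (auto intro!: bdd_belowI[of _ 0])
  have Ile: "I A \<le> q x" if "A \<in> F" "x \<in> A" for A x
    unfolding I_def using bb[OF that(1)] that(2) by (rule cINF_lower)
  have "I A \<le> B" if "A \<in> F" for A
    using bound[OF that] Ile[OF that] by force
  then have ba: "bdd_above (I ` F)" by (auto intro!: bdd_aboveI[of _ B])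
  show "\<exists>x\<in>A. q x < m + e" if "A \<in> F" "e > 0" for A e
  proof -
    have "I A \<le> m" unfolding m_def using ba that(1) by (simp add: cSUP_upper)
    then have "I A < m + e" using that by simp
    moreover have "A \<noteq> {}" using bound[OF that(1)] by auto
    ultimately show ?thesis unfolding I_def using bb[OF that(1)]
      by (subst (asm) cINF_less_iff) auto
  qed
  show "\<exists>A\<in>F. \<forall>x\<in>A. \<forall>y\<in>A. q x < m + e \<longrightarrow> q y < m + e \<longrightarrow> d x y \<le> 8 * e" if "e > 0" for e
  proof -
    have "m - e < (SUP A\<in>F. I A)" using that by (simp add: m_def)
    then obtain A where A: "A \<in> F" "m - e < I A"
      using ba assms(1) by (subst (asm) less_cSUP_iff) auto
    have "d x y \<le> 8 * e" if xy: "x \<in> A" "y \<in> A" "q x < m + e" "q y < m + e" for x y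
    proof -
      obtain z where z: "z \<in> A" "q z \<le> (q x + q y) / 2 - d x y / 4"
        using mid[OF A(1) xy(1,2)] by auto
      then have "m - e < (q x + q y) / 2 - d x y / 4" using A(2) Ile[OF A(1) z(1)] by linarith
      then show ?thesis using xy(3,4) by argo
    qed
    then show ?thesis using A(1) by blast
  qed
qed

text \<open>
  A list of pairs \<open>(s, w)\<close> stands for the finitely supported measure with mass \<open>w\<close> at \<open>s\<close>.
  Below, \<open>gram f\<close> is the inner product of such measures in the Hilbert space that a positive
  definite \<open>f\<close> defines.
\<close>

definition wsum :: "('g \<times> real) list \<Rightarrow> ('g \<Rightarrow> real) \<Rightarrow> real" where
  "wsum xs f = (\<Sum>(s, w)\<leftarrow>xs. w * f s)"

lemma wsum_Nil [simp]: "wsum [] f = 0"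
  and wsum_Cons [simp]: "wsum ((s, w) # xs) f = w * f s + wsum xs f"
  by (simp_all add: wsum_def)

lemma wsum_append [simp]: "wsum (xs @ ys) f = wsum xs f + wsum ys f"
  by (simp add: wsum_def)

lemma wsum_map: "wsum (map (\<lambda>(s, w). (a s, c * w)) xs) f = c * wsum xs (\<lambda>s. f (a s))"
  by (induction xs) (auto simp: algebra_simps)

lemma wsum_add: "wsum xs (\<lambda>s. f s + g s) = wsum xs f + wsum xs g"
  by (induction xs) (auto simp: algebra_simps)

lemma wsum_diff: "wsum xs (\<lambda>s. f s - g s) = wsum xs f - wsum xs g"
  by (induction xs) (auto simp: algebra_simps)

lemma wsum_mult: "wsum xs (\<lambda>s. c * f s) = c * wsum xs f"
  by (induction xs) (auto simp: algebra_simps)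

lemma wsum_swap: "wsum xs (\<lambda>s. wsum ys (\<lambda>t. f s t)) = wsum ys (\<lambda>t. wsum xs (\<lambda>s. f s t))"
  by (induction xs) (auto simp: wsum_add wsum_mult, induction ys, auto)

lemma wsum_cong: "(\<And>s w. (s, w) \<in> set xs \<Longrightarrow> f s = g s) \<Longrightarrow> wsum xs f = wsum xs g"
  unfolding wsum_def by (rule arg_cong[of _ _ sum_list]) (auto intro!: map_cong)

lemma wsum_upt: "wsum (map (\<lambda>i. (x i, b i)) [0..<n]) f = (\<Sum>i<n. b i * f (x i))"
  by (induction n) auto

definition prob_list :: "'g set \<Rightarrow> ('g \<times> real) list \<Rightarrow> bool" where
  "prob_list N xs \<longleftrightarrow> (\<forall>(s, w)\<in>set xs. s \<in> N \<and> 0 \<le> w) \<and> wsum xs (\<lambda>_. 1) = 1"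

lemma wsum_mono:
  assumes "\<And>s w. (s, w) \<in> set xs \<Longrightarrow> 0 \<le> w \<and> f s \<le> g s"
  shows "wsum xs f \<le> wsum xs g"
  using assms
proof (induction xs)
  case (Cons p xs)
  obtain s w where p: "p = (s, w)" by fastforce
  have "w * f s \<le> w * g s" using Cons.prems[of s w] p by (auto intro: mult_left_mono)
  moreover have "wsum xs f \<le> wsum xs g" using Cons.prems by (intro Cons.IH) auto
  ultimately show ?case by (simp add: p)
qed simp

lemma prob_list_mono: "prob_list N xs \<Longrightarrow> N \<subseteq> M \<Longrightarrow> prob_list M xs"
  by (fastforce simp: prob_list_def)

lemma wsum_const: "prob_list N xs \<Longrightarrow> wsum xs (\<lambda>_. c) = c"
  using wsum_mult[of xs c "\<lambda>_. 1"] by (simp add: prob_list_def)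

lemma wsum_le:
  assumes "prob_list N xs" "\<And>s. s \<in> N \<Longrightarrow> f s \<le> c"
  shows "wsum xs f \<le> c"
proof -
  have "wsum xs f \<le> wsum xs (\<lambda>_. c)"
    using assms by (intro wsum_mono) (auto simp: prob_list_def)
  then show ?thesis using wsum_const[OF assms(1)] by simp
qed

lemma wsum_ge:
  assumes "prob_list N xs" "\<And>s. s \<in> N \<Longrightarrow> c \<le> f s"
  shows "c \<le> wsum xs f"
proof -
  have "wsum xs (\<lambda>_. c) \<le> wsum xs f"
    using assms by (intro wsum_mono) (auto simp: prob_list_def)
  then show ?thesis using wsum_const[OF assms(1)] by simp
qed

lemma wsum_dist:
  assumes "prob_list N xs" "\<And>s. s \<in> N \<Longrightarrow> \<bar>f s - c\<bar> \<le> e"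
  shows "\<bar>wsum xs f - c\<bar> \<le> e"
proof -
  have "wsum xs f \<le> c + e" using assms(2) by (intro wsum_le[OF assms(1)]) (fastforce simp: abs_le_iff)
  moreover have "c - e \<le> wsum xs f" using assms(2) by (intro wsum_ge[OF assms(1)]) (fastforce simp: abs_le_iff)
  ultimately show ?thesis by (simp add: abs_le_iff)
qed

lemma prob_list_mid:
  assumes "prob_list N xs" "prob_list N ys"
  shows "prob_list N (map (\<lambda>(s, w). (s, 1/2 * w)) xs @ map (\<lambda>(s, w). (s, 1/2 * w)) ys)"
  using assms unfolding prob_list_def wsum_append wsum_map[of "\<lambda>s. s", simplified] by auto

lemma prob_list_translate:
  assumes "prob_list N xs" "\<And>s w. (s, w) \<in> set xs \<Longrightarrow> a + s \<in> M"
  shows "prob_list M (map (\<lambda>(s, w). (a + s, 1 * w)) xs)"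
  using assms unfolding prob_list_def wsum_map by auto

definition gram :: "('g::group_add \<Rightarrow> real) \<Rightarrow> ('g \<times> real) list \<Rightarrow> ('g \<times> real) list \<Rightarrow> real" where
  "gram f xs ys = wsum xs (\<lambda>s. wsum ys (\<lambda>t. f (- s + t)))"

text \<open>Only real weights are tested. Complex weights would force evenness; with real ones it
  has to be required separately, and for a real-valued function the two together amount to the
  complex condition.\<close>

definition pos_def :: "('g::group_add \<Rightarrow> real) \<Rightarrow> bool" where
  "pos_def f \<longleftrightarrow> (\<forall>x. f (- x) = f x) \<and> (\<forall>xs. 0 \<le> gram f xs xs)"

lemma gram_append_left [simp]: "gram f (xs @ ys) zs = gram f xs zs + gram f ys zs"
  by (simp add: gram_def)

lemma gram_append_right [simp]: "gram f zs (xs @ ys) = gram f zs xs + gram f zs ys"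
  by (simp add: gram_def wsum_add)

lemma gram_scale_left: "gram f (map (\<lambda>(s, w). (s, c * w)) xs) zs = c * gram f xs zs"
  using wsum_map[of "\<lambda>s. s" c xs] by (simp add: gram_def)

lemma gram_scale_right: "gram f zs (map (\<lambda>(s, w). (s, c * w)) xs) = c * gram f zs xs"
  using wsum_map[of "\<lambda>s. s" c xs] by (simp add: gram_def wsum_mult)

lemma gram_sym:
  assumes "pos_def f" shows "gram f xs ys = gram f ys xs"
proof -
  have "f (- s + t) = f (- t + s)" for s t
    using assms unfolding pos_def_def by (metis minus_add minus_minus)
  then show ?thesis unfolding gram_def by (subst wsum_swap) simp
qed

lemma gram_translate:
  "gram f (map (\<lambda>(s, w). (a + s, 1 * w)) xs) (map (\<lambda>(s, w). (a + s, 1 * w)) ys) = gram f xs ys"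
proof -
  have "- (a + s) + (a + t) = - s + t" for s t by (simp only: minus_add add.assoc minus_add_cancel)
  then show ?thesis unfolding gram_def wsum_map by simp
qed

text \<open>The measure \<open>xs\<close> minus \<open>g\<close> times the point mass at
  \<open>x\<close> has nonnegative squared norm, and point masses have squared norm
  \<open>f 0 \<le> 1\<close>. So evaluation at any point has norm at most 1, and norm estimates
  between averages become estimates uniform in \<open>x\<close>.\<close>

lemma gram_Cauchy_Schwarz:
  assumes "pos_def f" "f 0 \<le> 1"
  shows "(gram f xs [(x, 1)])\<^sup>2 \<le> gram f xs xs"
proof -
  define g where "g = gram f xs [(x, 1)]"
  have xx: "gram f [(x, a)] [(x, b)] = a * b * f 0" for a b by (simp add: gram_def)
  have xg: "gram f xs [(x, - g)] = - g * g"
    using gram_scale_right[of f xs "- g" "[(x, 1)]"] by (simp add: g_def)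
  have "0 \<le> gram f (xs @ [(x, - g)]) (xs @ [(x, - g)])"
    using assms(1) unfolding pos_def_def by blast
  also have "\<dots> = gram f xs xs + 2 * (- g * g) + g * g * f 0"
    using xg gram_sym[OF assms(1), of xs "[(x, - g)]"] by (simp add: xx)
  also have "\<dots> \<le> gram f xs xs - g * g"
    using mult_left_mono[OF assms(2), of "g * g"] by simp
  finally show ?thesis by (simp add: g_def power2_eq_square)
qed

text \<open>Nonnegativity is tested on the points 0 and \<open>x\<close> with weights 1 and
  \<open>c\<close>, for \<open>c = 1\<close> and \<open>c = -1\<close>.\<close>

lemma pos_def_le: assumes "pos_def f" shows "\<bar>f x\<bar> \<le> f 0"
proof -
  have *: "0 \<le> gram f [(0, 1), (x, c)] [(0, 1), (x, c)]" for c
    using assms unfolding pos_def_def by blast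
  have "f (- x) = f x" using assms by (simp add: pos_def_def)
  then have "0 \<le> f 0 + c * f x + (c * f x + c * c * f 0)" for c
    using *[of c] by (simp add: gram_def algebra_simps)
  from this[of 1] this[of "-1"] show ?thesis by (simp add: abs_le_iff)
qed

lemma pos_def_scale: "pos_def f \<Longrightarrow> 0 \<le> c \<Longrightarrow> pos_def (\<lambda>x. c * f x)"
  unfolding pos_def_def gram_def by (simp add: wsum_mult)

lemma pos_def_add: "pos_def f \<Longrightarrow> pos_def g \<Longrightarrow> pos_def (\<lambda>x. f x + g x)"
  unfolding pos_def_def gram_def by (simp add: wsum_add)

lemma tendsto_wsum:
  "(\<And>s w. (s, w) \<in> set xs \<Longrightarrow> ((\<lambda>n. f n s) \<longlongrightarrow> g s) F) \<Longrightarrow> ((\<lambda>n. wsum xs (f n)) \<longlongrightarrow> wsum xs g) F"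
proof (induction xs)
  case (Cons p xs)
  then show ?case by (cases p) (fastforce intro!: tendsto_intros)
qed simp

text \<open>Each condition in \<open>pos_def\<close> involves finitely many values of
  \<open>h\<close>, so the approximating function may change with the finite set \<open>Y\<close>;
  no single sequence has to converge everywhere.\<close>

lemma pos_def_approx:
  fixes h :: "'g::group_add \<Rightarrow> real"
  assumes "\<And>Y e. finite Y \<Longrightarrow> e > 0 \<Longrightarrow> \<exists>g. pos_def g \<and> (\<forall>y\<in>Y. \<bar>g y - h y\<bar> < e)"
  shows "pos_def h"
proof -
  have seq: "\<exists>g. (\<forall>n::nat. pos_def (g n)) \<and> (\<forall>y\<in>Y. (\<lambda>n. g n y) \<longlonglongrightarrow> h y)" if Y: "finite Y" for Y
  proof -
    have "\<exists>g. pos_def g \<and> (\<forall>y\<in>Y. \<bar>g y - h y\<bar> < inverse (real (Suc n)))" for n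
      by (rule assms[OF Y]) simp
    then obtain g where g: "\<And>n. pos_def (g n)"
      "\<And>n y. y \<in> Y \<Longrightarrow> \<bar>g n y - h y\<bar> < inverse (real (Suc n))" by metis
    have "(\<lambda>n. g n y) \<longlonglongrightarrow> h y" if "y \<in> Y" for y
    proof -
      have "(\<lambda>n. g n y - h y) \<longlonglongrightarrow> 0"
        by (rule tendsto_rabs_zero_cancel, rule tendsto_sandwich[OF _ _ tendsto_const LIMSEQ_inverse_real_of_nat])
          (use g(2)[OF that] in \<open>auto intro!: always_eventually less_imp_le\<close>)
      then show ?thesis by (rule LIM_zero_cancel)
    qed
    then show ?thesis using g(1) by blast
  qed
  show ?thesis unfolding pos_def_def
  proof safe
    fix x :: 'g
    obtain g where g: "\<And>n::nat. pos_def (g n)" "\<forall>y\<in>{x, - x}. (\<lambda>n. g n y) \<longlonglongrightarrow> h y"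
      using seq[of "{x, - x}"] by auto
    from g(1) have "g n (- x) = g n x" for n by (simp add: pos_def_def)
    then show "h (- x) = h x" using g(2) LIMSEQ_unique by fastforce
  next
    fix xs :: "('g \<times> real) list"
    define Y where "Y = (\<lambda>(s, t). - s + t) ` (fst ` set xs \<times> fst ` set xs)"
    have Y: "- s + t \<in> Y" if "(s, v) \<in> set xs" "(t, w) \<in> set xs" for s t v w
      using that unfolding Y_def by force
    obtain g where g: "\<And>n::nat. pos_def (g n)" "\<forall>y\<in>Y. (\<lambda>n. g n y) \<longlonglongrightarrow> h y"
      using seq[of Y] by (auto simp: Y_def)
    have "(\<lambda>n. gram (g n) xs xs) \<longlonglongrightarrow> gram h xs xs"
      unfolding gram_def using g(2) Y by (intro tendsto_wsum) blast
    moreover have "0 \<le> gram (g n) xs xs" for n using g(1) by (simp add: pos_def_def)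
    ultimately show "0 \<le> gram h xs xs" by (simp add: LIMSEQ_le_const)
  qed
qed

text \<open>The filter is arbitrary because the lemma serves a cluster point on an uncountable
  product, where no subsequence need converge.\<close>

lemma pos_def_limit:
  fixes f :: "'n \<Rightarrow> 'g::group_add \<Rightarrow> real"
  assumes F: "F \<noteq> bot" and pd: "\<forall>\<^sub>F n in F. pos_def (f n)" and lim: "\<And>x. ((\<lambda>n. f n x) \<longlongrightarrow> g x) F"
  shows "pos_def g"
proof (rule pos_def_approx)
  fix Y :: "'g set" and e :: real
  assume Y: "finite Y" and e: "e > 0"
  have "\<forall>\<^sub>F n in F. \<bar>f n y - g y\<bar> < e" for y
    using tendstoD[OF lim e, of y] by (simp add: dist_real_def)
  then have "\<forall>\<^sub>F n in F. \<forall>y\<in>Y. \<bar>f n y - g y\<bar> < e" using Y by (simp add: eventually_ball_finite)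
  with pd have "\<forall>\<^sub>F n in F. pos_def (f n) \<and> (\<forall>y\<in>Y. \<bar>f n y - g y\<bar> < e)"
    by (rule eventually_conj)
  then show "\<exists>g'. pos_def g' \<and> (\<forall>y\<in>Y. \<bar>g' y - g y\<bar> < e)"
    using F eventually_happens by blast
qed


definition convolve_list :: "('g::group_add \<times> real) list \<Rightarrow> ('g \<times> real) list \<Rightarrow> ('g \<times> real) list" where
  "convolve_list zs xs = concat (map (\<lambda>(z, a). map (\<lambda>(s, w). (z + s, a * w)) xs) zs)"

lemma wsum_convolve_list: "wsum (convolve_list zs xs) f = wsum zs (\<lambda>z. wsum xs (\<lambda>s. f (z + s)))"
  by (induction zs) (auto simp: convolve_list_def wsum_map)

text \<open>This is the matrix coefficient of the vector \<open>xs\<close> under left translation: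
  its Gram sum over \<open>zs\<close> is the squared norm of the convolution of \<open>zs\<close>
  and \<open>xs\<close>.\<close>

lemma pos_def_gram_translate:
  assumes "pos_def f"
  shows "pos_def (\<lambda>y. gram f xs (map (\<lambda>(s, w). (y + s, 1 * w)) xs))"
  unfolding pos_def_def
proof safe
  fix y
  have "gram f xs (map (\<lambda>(s, w). (- y + s, 1 * w)) xs)
      = gram f (map (\<lambda>(s, w). (y + s, 1 * w)) xs)
          (map (\<lambda>(s, w). (y + s, 1 * w)) (map (\<lambda>(s, w). (- y + s, 1 * w)) xs))"
    by (rule gram_translate[symmetric])
  also have "map (\<lambda>(s, w). (y + s, 1 * w)) (map (\<lambda>(s, w). (- y + s, 1 * w)) xs) = xs"
    by (induction xs) (auto simp: add.assoc[symmetric])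
  finally show "gram f xs (map (\<lambda>(s, w). (- y + s, 1 * w)) xs)
      = gram f xs (map (\<lambda>(s, w). (y + s, 1 * w)) xs)"
    using gram_sym[OF assms] by metis
next
  fix zs
  have eq: "- (z + s) + (z' + t) = - s + (- z + z' + t)" for z s z' t :: 'a
    by (simp only: minus_add add.assoc)
  have "gram f (convolve_list zs xs) (convolve_list zs xs)
      = wsum zs (\<lambda>z. wsum xs (\<lambda>s. wsum zs (\<lambda>z'. wsum xs (\<lambda>t. f (- (z + s) + (z' + t))))))"
    by (simp only: gram_def wsum_convolve_list)
  also have "\<dots> = wsum zs (\<lambda>z. wsum zs (\<lambda>z'. wsum xs (\<lambda>s. wsum xs (\<lambda>t. f (- (z + s) + (z' + t))))))"
    by (subst wsum_swap) simp
  also have "\<dots> = gram (\<lambda>y. gram f xs (map (\<lambda>(s, w). (y + s, 1 * w)) xs)) zs zs"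
    unfolding gram_def wsum_map eq by simp
  finally show "0 \<le> gram (\<lambda>y. gram f xs (map (\<lambda>(s, w). (y + s, 1 * w)) xs)) zs zs"
    using assms unfolding pos_def_def by metis
qed

text \<open>
  The minimal norm of an average of translates of \<open>f\<close> by points of \<open>N\<close> increases as \<open>N\<close> shrinks
  to \<open>0\<close>; the limit of this norm is the square root of \<open>m\<close>, and almost minimal averages are Cauchy.
\<close>

lemma averages_converge:
  fixes f :: "'g::topological_group_add \<Rightarrow> real"
  assumes f: "pos_def f" "f 0 \<le> 1"
  obtains h m where
    "\<And>N e. open N \<Longrightarrow> 0 \<in> N \<Longrightarrow> e > 0 \<Longrightarrow> \<exists>xs. prob_list N xs \<and> gram f xs xs < m + e"
    "\<And>e. e > 0 \<Longrightarrow> \<exists>N d. open N \<and> 0 \<in> N \<and> d > 0 \<and>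
       (\<forall>xs x. prob_list N xs \<longrightarrow> gram f xs xs < m + d \<longrightarrow> \<bar>wsum xs (\<lambda>s. f (- s + x)) - h x\<bar> \<le> e)"
proof -
  define q where "q xs = gram f xs xs" for xs
  define d where "d xs ys = q xs - 2 * gram f xs ys + q ys" for xs ys
  define av where "av xs x = wsum xs (\<lambda>s. f (- s + x))" for xs x
  define F where "F = (\<lambda>N. {xs. prob_list N xs}) ` {N. open N \<and> (0::'g) \<in> N}"
  have dq: "q (xs @ map (\<lambda>(s, w). (s, - 1 * w)) ys) = d xs ys" for xs ys
    unfolding q_def d_def gram_append_left gram_append_right gram_scale_left gram_scale_right
    using gram_sym[OF f(1), of xs ys] by simp
  have av_gram: "av xs x = gram f xs [(x, 1)]" for xs x by (simp add: av_def gram_def)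
  have CS: "(av xs x - av ys x)\<^sup>2 \<le> d xs ys" for xs ys x
  proof -
    have "av xs x - av ys x = gram f (xs @ map (\<lambda>(s, w). (s, - 1 * w)) ys) [(x, 1)]"
      unfolding av_gram gram_append_left gram_scale_left by simp
    then show ?thesis using gram_Cauchy_Schwarz[OF f] dq unfolding q_def by metis
  qed
  obtain m where m1: "\<And>A e. A \<in> F \<Longrightarrow> e > 0 \<Longrightarrow> \<exists>x\<in>A. q x < m + e"
    and m2: "\<And>e. e > 0 \<Longrightarrow> \<exists>A\<in>F. \<forall>x\<in>A. \<forall>y\<in>A. q x < m + e \<longrightarrow> q y < m + e \<longrightarrow> d x y \<le> 8 * e"
  proof (rule near_minimal[of F q 1 d])
    show "F \<noteq> {}" unfolding F_def by auto
    show "0 \<le> q x" for x using f(1) by (simp add: q_def pos_def_def)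
    \<comment> \<open>The point mass at 0 belongs to every set of \<open>F\<close>.\<close>
    show "\<exists>x\<in>A. q x \<le> 1" if "A \<in> F" for A
      using that f(2) by (auto simp: F_def q_def prob_list_def gram_def intro!: exI[of _ "[(0,1)]"])
    show "\<exists>z\<in>A. q z \<le> (q x + q y) / 2 - d x y / 4" if A: "A \<in> F" and xy: "x \<in> A" "y \<in> A" for A x y
    proof -
      define z where "z = map (\<lambda>(s, w). (s, 1/2 * w)) x @ map (\<lambda>(s, w). (s, 1/2 * w)) y"
      have "z \<in> A" using A xy unfolding F_def z_def by (auto intro!: prob_list_mid[simplified])
      moreover have "q z = (q x + q y) / 2 - d x y / 4"
        unfolding z_def d_def q_def gram_append_left gram_append_right gram_scale_left gram_scale_right
        using gram_sym[OF f(1), of x y] by (simp add: field_simps)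
      ultimately show ?thesis by force
    qed
  qed auto
  define r where "r n = inverse (real (Suc n))" for n
  have r: "r n > 0" for n by (simp add: r_def)
  have r_mono: "r j \<le> r i" if "i \<le> j" for i j using that by (simp add: r_def)
  have "\<forall>n. \<exists>N. open N \<and> (0::'g) \<in> N \<and> (\<forall>x y. prob_list N x \<longrightarrow> prob_list N y \<longrightarrow>
      q x < m + r n \<longrightarrow> q y < m + r n \<longrightarrow> d x y \<le> 8 * r n)"
  proof
    fix n
    show "\<exists>N. open N \<and> (0::'g) \<in> N \<and> (\<forall>x y. prob_list N x \<longrightarrow> prob_list N y \<longrightarrow>
      q x < m + r n \<longrightarrow> q y < m + r n \<longrightarrow> d x y \<le> 8 * r n)"
      using m2[OF r, of n] unfolding F_def by auto
  qed
  from this[THEN choice] obtain N where N: "\<And>n. open (N n)" "\<And>n. (0::'g) \<in> N n"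
    "\<And>n x y. prob_list (N n) x \<Longrightarrow> prob_list (N n) y \<Longrightarrow>
      q x < m + r n \<Longrightarrow> q y < m + r n \<Longrightarrow> d x y \<le> 8 * r n" by blast
  \<comment> \<open>The neighbourhoods \<open>N i\<close> are chosen independently of each other.
    Intersecting the first of them puts \<open>xs j\<close> into every \<open>N i\<close> with
    \<open>i \<le> j\<close>, so that it can be compared at all earlier levels.\<close>
  have "\<exists>xs. prob_list (\<Inter>i\<le>n. N i) xs \<and> q xs < m + r n" for n
    using m1[of "{xs. prob_list (\<Inter>i\<le>n. N i) xs}", OF _ r, of n] N(1,2) unfolding F_def by auto
  then obtain xs where xs: "\<And>n. prob_list (\<Inter>i\<le>n. N i) (xs n)" "\<And>n. q (xs n) < m + r n" by metis
  have xs_in: "prob_list (N i) (xs j)" if "i \<le> j" for i j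
    by (rule prob_list_mono[OF xs(1)[of j]]) (use that in auto)
  have xs_q: "q (xs j) < m + r i" if "i \<le> j" for i j
    using xs(2)[of j] r_mono[OF that] by simp
  have close: "(av ys x - av (xs j) x)\<^sup>2 \<le> 8 * r i"
    if "i \<le> j" "prob_list (N i) ys" "q ys < m + r i" for i j ys x
    using CS[of ys x "xs j"] N(3)[OF that(2) xs_in[OF that(1)] that(3) xs_q[OF that(1)]] by simp
  have small: "\<exists>i. 8 * r i < e\<^sup>2" if "e > 0" for e :: real
  proof -
    have "0 < e\<^sup>2 / 8" using that by simp
    then obtain n where "r n < e\<^sup>2 / 8" unfolding r_def using reals_Archimedean by blast
    then show ?thesis by (intro exI[of _ n]) linarith
  qed
  have "convergent (\<lambda>n. av (xs n) x)" for x
  proof (rule Cauchy_convergent, rule metric_CauchyI)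
    fix e :: real assume e: "e > 0"
    obtain i where i: "8 * r i < e\<^sup>2" using small[OF e] by blast
    have "dist (av (xs k) x) (av (xs j) x) < e" if "i \<le> k" "i \<le> j" for j k
    proof -
      have "(av (xs k) x - av (xs j) x)\<^sup>2 < e\<^sup>2"
        using close[OF that(2) xs_in[OF that(1)] xs_q[OF that(1)]] i by (rule le_less_trans)
      then have "\<bar>av (xs k) x - av (xs j) x\<bar> < e"
        by (rule power2_less_imp_less[where y = e, OF _ less_imp_le[OF e], of "\<bar>av (xs k) x - av (xs j) x\<bar>", unfolded power2_abs])
      then show ?thesis using e by (simp add: dist_real_def)
    qed
    then show "\<exists>M. \<forall>m\<ge>M. \<forall>n\<ge>M. dist (av (xs m) x) (av (xs n) x) < e" by blast
  qed
  then obtain h where h: "\<And>x. (\<lambda>n. av (xs n) x) \<longlonglongrightarrow> h x" unfolding convergent_def by metis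
  have conv: "\<exists>N d. open N \<and> 0 \<in> N \<and> d > 0 \<and>
       (\<forall>ys x. prob_list N ys \<longrightarrow> gram f ys ys < m + d \<longrightarrow> \<bar>wsum ys (\<lambda>s. f (- s + x)) - h x\<bar> \<le> e)"
    if e: "e > 0" for e
  proof -
    obtain i where i: "8 * r i < e\<^sup>2" using small[OF e] by blast
    have "\<bar>av ys x - h x\<bar> \<le> e" if ys: "prob_list (N i) ys" "q ys < m + r i" for ys x
    proof -
      have "(\<lambda>n. (av ys x - av (xs n) x)\<^sup>2) \<longlonglongrightarrow> (av ys x - h x)\<^sup>2"
        by (intro tendsto_intros h)
      moreover have "\<exists>M. \<forall>n\<ge>M. (av ys x - av (xs n) x)\<^sup>2 \<le> 8 * r i"
        using close[OF _ ys] by blast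
      ultimately have "(av ys x - h x)\<^sup>2 \<le> 8 * r i" by (rule LIMSEQ_le_const2)
      then have "(av ys x - h x)\<^sup>2 \<le> e\<^sup>2" using i by linarith
      then have "\<bar>av ys x - h x\<bar> \<le> \<bar>e\<bar>" by (simp only: abs_le_square_iff)
      then show ?thesis using e by simp
    qed
    then show ?thesis using N(1,2) r unfolding q_def av_def by metis
  qed
  have near: "\<exists>xs. prob_list N xs \<and> gram f xs xs < m + e" if "open N" "0 \<in> N" "e > 0" for N e
    using m1[of "{xs. prob_list N xs}" e] that unfolding F_def q_def by auto
  show ?thesis by (rule that[OF near conv])
qed

text \<open>
  The limit of almost minimal averages is the projection of \<open>f\<close> to the continuous vectors of its
  representation: translating an average by a small \<open>a\<close> keeps its norm and almost its support, so
  it stays close to the limit.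
\<close>

lemma continuous_part:
  fixes f :: "'g::topological_group_add \<Rightarrow> real"
  assumes f: "pos_def f" "f 0 \<le> 1"
  obtains h where "pos_def h" "continuous_on UNIV h"
    "\<And>N e. open N \<Longrightarrow> 0 \<in> N \<Longrightarrow> e > 0 \<Longrightarrow>
       \<exists>xs. prob_list N xs \<and> (\<forall>x. \<bar>wsum xs (\<lambda>s. f (- s + x)) - h x\<bar> \<le> e)"
proof -
  define av where "av xs x = wsum xs (\<lambda>s. f (- s + x))" for xs x
  obtain h m where near: "\<And>N e. open N \<Longrightarrow> 0 \<in> N \<Longrightarrow> e > 0 \<Longrightarrow> \<exists>xs. prob_list N xs \<and> gram f xs xs < m + e"
    and conv: "\<And>e. e > 0 \<Longrightarrow> \<exists>N d. open N \<and> 0 \<in> N \<and> d > 0 \<and>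
       (\<forall>xs x. prob_list N xs \<longrightarrow> gram f xs xs < m + d \<longrightarrow> \<bar>av xs x - h x\<bar> \<le> e)"
    using averages_converge[OF f] unfolding av_def by metis
  have cont: "\<exists>M. open M \<and> 0 \<in> M \<and> (\<forall>a\<in>M. \<forall>x. \<bar>h (- a + x) - h x\<bar> \<le> 2 * e)" if e: "e > 0" for e
  proof -
    obtain N d where N: "open N" "0 \<in> N" "d > 0"
      "\<And>xs x. prob_list N xs \<Longrightarrow> gram f xs xs < m + d \<Longrightarrow> \<bar>av xs x - h x\<bar> \<le> e"
      using conv[OF e] by blast
    obtain xs where xs: "prob_list N xs" "gram f xs xs < m + d" using near[OF N(1-3)] by blast
    \<comment> \<open>\<open>xs\<close> has finite support, so this is a neighbourhood of 0;
      translation by its elements keeps the average supported in \<open>N\<close>.\<close>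
    define M where "M = (\<Inter>s\<in>fst ` set xs. (\<lambda>a. a + s) -` N)"
    have "open M" unfolding M_def using N(1)
      by (auto intro!: open_INT open_vimage continuous_intros)
    moreover have "0 \<in> M" using xs(1) unfolding M_def prob_list_def by auto
    moreover have "\<bar>h (- a + x) - h x\<bar> \<le> 2 * e" if a: "a \<in> M" for a x
    proof -
      define ys where "ys = map (\<lambda>(s, w). (a + s, 1 * w)) xs"
      have "prob_list N ys" unfolding ys_def
        by (rule prob_list_translate[OF xs(1)]) (use a in \<open>auto simp: M_def\<close>)
      moreover have "gram f ys ys < m + d" unfolding ys_def gram_translate by (rule xs(2))
      ultimately have "\<bar>av ys x - h x\<bar> \<le> e" by (rule N(4))
      moreover have "av ys x = av xs (- a + x)"
        unfolding av_def ys_def wsum_map by (simp only: minus_add add.assoc mult_1)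
      moreover have "\<bar>av xs (- a + x) - h (- a + x)\<bar> \<le> e" by (rule N(4)[OF xs])
      ultimately show ?thesis by linarith
    qed
    ultimately show ?thesis by blast
  qed
  have nbhd: "\<exists>M. open M \<and> x \<in> M \<and> (\<forall>y\<in>M. \<bar>h y - h x\<bar> < e)" if "e > 0" for e x
  proof -
    have "e / 3 > 0" using that by simp
    from cont[OF this] obtain M where M: "open M" "0 \<in> M" "\<And>a x. a \<in> M \<Longrightarrow> \<bar>h (- a + x) - h x\<bar> \<le> 2 * (e / 3)"
      by blast
    have "open ((\<lambda>y. x + - y) -` M)" using M(1) by (intro open_vimage continuous_intros)
    moreover have "\<bar>h y - h x\<bar> < e" if "x + - y \<in> M" for y
      using M(3)[OF that, of x] \<open>e > 0\<close> by (simp add: minus_add)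
    ultimately show ?thesis using M(2) by (intro exI[of _ "(\<lambda>y. x + - y) -` M"]) auto
  qed
  have "continuous_on UNIV h"
  proof (subst continuous_on_def, intro ballI)
    fix x
    show "(h \<longlongrightarrow> h x) (at x within UNIV)"
    proof (rule tendstoI)
      fix e :: real assume "e > 0"
      then obtain M where "open M" "x \<in> M" "\<forall>y\<in>M. \<bar>h y - h x\<bar> < e" using nbhd by blast
      then show "\<forall>\<^sub>F y in at x. dist (h y) (h x) < e"
        unfolding eventually_at_topological dist_real_def by blast
    qed
  qed
  moreover have "pos_def h"
  proof (rule pos_def_approx)
    fix Y :: "'g set" and e :: real assume Y: "finite Y" and e: "e > 0"
    then have e3: "e / 3 > 0" by simp
    obtain N d where N: "open N" "0 \<in> N" "d > 0"
      "\<And>xs x. prob_list N xs \<Longrightarrow> gram f xs xs < m + d \<Longrightarrow> \<bar>av xs x - h x\<bar> \<le> e / 3"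
      using conv[OF e3] by blast
    have "\<forall>y. \<exists>M. open M \<and> y \<in> M \<and> (\<forall>z\<in>M. \<bar>h z - h y\<bar> < e / 3)" using nbhd[OF e3] by blast
    then obtain M where M: "\<And>y. open (M y)" "\<And>y. y \<in> M y" "\<And>y z. z \<in> M y \<Longrightarrow> \<bar>h z - h y\<bar> < e / 3"
      by metis
    \<comment> \<open>\<open>N'\<close> depends on \<open>Y\<close>: for \<open>y\<close> in
      \<open>Y\<close>, shifting the argument from \<open>y\<close> to \<open>y + t\<close> with
      \<open>t\<close> in \<open>N'\<close> must hardly change \<open>h\<close>.\<close>
    define N' where "N' = N \<inter> (\<Inter>y\<in>Y. (\<lambda>t. y + t) -` M y)"
    have "open N'" unfolding N'_def using N(1) M(1) Y
      by (auto intro!: open_INT open_Int open_vimage continuous_intros)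
    moreover have "0 \<in> N'" using N(2) M(2) by (auto simp: N'_def)
    ultimately obtain xs where xs: "prob_list N' xs" "gram f xs xs < m + d" using near N(3) by blast
    have xsN: "prob_list N xs" using xs(1) by (rule prob_list_mono) (simp add: N'_def)
    \<comment> \<open>A double average of \<open>f\<close>. One copy of \<open>xs\<close> produces
      \<open>av xs\<close>, which is uniformly close to \<open>h\<close>; the other only moves the
      argument within \<open>N'\<close>.\<close>
    define g where "g = (\<lambda>y. gram f xs (map (\<lambda>(s, w). (y + s, 1 * w)) xs))"
    have "\<bar>g y - h y\<bar> < e" if "y \<in> Y" for y
    proof -
      have "g y = wsum xs (\<lambda>t. av xs (y + t))"
        unfolding g_def gram_def av_def wsum_map by (subst wsum_swap) simp
      moreover have "\<bar>wsum xs (\<lambda>t. av xs (y + t)) - h y\<bar> \<le> 2 * (e / 3)"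
      proof (rule wsum_dist[OF xs(1)])
        fix t assume "t \<in> N'"
        then have "\<bar>h (y + t) - h y\<bar> < e / 3" using that M(3) by (auto simp: N'_def)
        with N(4)[OF xsN xs(2), of "y + t"] show "\<bar>av xs (y + t) - h y\<bar> \<le> 2 * (e / 3)" by linarith
      qed
      ultimately show ?thesis using e by linarith
    qed
    moreover have "pos_def g" unfolding g_def by (rule pos_def_gram_translate[OF f(1)])
    ultimately show "\<exists>g. pos_def g \<and> (\<forall>y\<in>Y. \<bar>g y - h y\<bar> < e)" by blast
  qed
  moreover have "\<exists>xs. prob_list N xs \<and> (\<forall>x. \<bar>av xs x - h x\<bar> \<le> e)" if N: "open N" "0 \<in> N" "e > 0" for N e
  proof -
    obtain M d where M: "open M" "0 \<in> M" "d > 0"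
      "\<And>xs x. prob_list M xs \<Longrightarrow> gram f xs xs < m + d \<Longrightarrow> \<bar>av xs x - h x\<bar> \<le> e"
      using conv[OF N(3)] by blast
    obtain xs where xs: "prob_list (N \<inter> M) xs" "gram f xs xs < m + d"
      using near[of "N \<inter> M" d] N M by auto
    have "prob_list N xs" "prob_list M xs" using xs(1) by (auto elim: prob_list_mono)
    then show ?thesis using M(4) xs(2) by blast
  qed
  ultimately show ?thesis
    by (intro that[of h]) (auto simp: av_def)
qed


section \<open>Maximisers among continuous positive definite functions\<close>

text \<open>Intended for a majorant minus a candidate: upper bounds for these differences are lower
  bounds for the integrals of the candidates. Integrability of the limit is part of the conclusion,
  since nothing else provides it.\<close>

lemma integral_Fatou:
  fixes f :: "nat \<Rightarrow> 'a \<Rightarrow> real"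
  assumes int: "\<And>n. integrable M (f n)" and nonneg: "\<And>n. AE x in M. 0 \<le> f n x"
    and g: "g \<in> borel_measurable M" and lim: "AE x in M. (\<lambda>n. f n x) \<longlonglongrightarrow> g x"
    and le: "\<And>n. (\<integral>x. f n x \<partial>M) \<le> B n" and B: "B \<longlonglongrightarrow> b"
  shows "integrable M g \<and> (\<integral>x. g x \<partial>M) \<le> b"
proof -
  have "AE x in M. \<forall>n. 0 \<le> f n x" using nonneg by (simp add: AE_all_countable)
  then have g0: "AE x in M. 0 \<le> g x"
    using lim by eventually_elim (auto intro: LIMSEQ_le_const)
  have "0 \<le> (\<integral>x. f n x \<partial>M)" for n using nonneg by (rule integral_nonneg_AE)
  then have B0: "0 \<le> B n" for n using le order_trans by blast
  then have b0: "0 \<le> b" using B by (auto intro: LIMSEQ_le_const)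
  have "(\<integral>\<^sup>+x. ennreal (g x) \<partial>M) = (\<integral>\<^sup>+x. liminf (\<lambda>n. ennreal (f n x)) \<partial>M)"
  proof (rule nn_integral_cong_AE)
    show "AE x in M. ennreal (g x) = liminf (\<lambda>n. ennreal (f n x))"
      using lim
    proof eventually_elim
      case (elim x)
      then have "(\<lambda>n. ennreal (f n x)) \<longlonglongrightarrow> ennreal (g x)" by (rule tendsto_ennrealI)
      then show ?case by (simp add: lim_imp_Liminf)
    qed
  qed
  also have "\<dots> \<le> liminf (\<lambda>n. \<integral>\<^sup>+x. ennreal (f n x) \<partial>M)"
    using int by (intro nn_integral_liminf) auto
  also have "\<dots> \<le> liminf (\<lambda>n. ennreal (B n))"
    using int nonneg le by (intro Liminf_mono always_eventually allI) (simp add: nn_integral_eq_integral ennreal_leI)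
  also have "\<dots> = ennreal b"
    by (rule lim_imp_Liminf) (auto intro: tendsto_ennrealI B)
  finally have le_b: "(\<integral>\<^sup>+x. ennreal (g x) \<partial>M) \<le> ennreal b" .
  then have "integrable M g"
    using g g0 by (intro integrableI_nonneg) (auto intro: le_less_trans)
  moreover from this have "(\<integral>x. g x \<partial>M) \<le> b"
    using le_b g0 b0 by (simp add: nn_integral_eq_integral)
  ultimately show ?thesis by simp
qed

text \<open>The weights \<open>4 ^ n\<close> against the rate \<open>(1 / 8) ^ n\<close> leave the
  integrable series of \<open>(1 / 2) ^ n\<close>. Almost everywhere the weighted series has a
  finite sum \<open>C\<close>, so consecutive terms differ by at most
  \<open>sqrt C * (1 / 2) ^ n\<close>. This works on spaces of infinite measure, where square
  integrability does not give integrability.\<close>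

lemma AE_convergent_of_L2_summable:
  fixes f :: "nat \<Rightarrow> 'a \<Rightarrow> real"
  assumes [measurable]: "\<And>n. f n \<in> borel_measurable M"
    and le: "\<And>n. (\<integral>\<^sup>+x. ennreal ((f n x - f (Suc n) x)\<^sup>2) \<partial>M) \<le> ennreal ((1 / 8) ^ n)"
  shows "AE x in M. convergent (\<lambda>n. f n x)"
proof -
  define D where "D n x = 4 ^ n * (f n x - f (Suc n) x)\<^sup>2" for n x
  have [measurable]: "D n \<in> borel_measurable M" for n unfolding D_def by measurable
  have "(\<integral>\<^sup>+x. (\<Sum>n. ennreal (D n x)) \<partial>M) = (\<Sum>n. \<integral>\<^sup>+x. ennreal (D n x) \<partial>M)"
    by (rule nn_integral_suminf) measurable
  also have "\<dots> \<le> (\<Sum>n. ennreal ((1 / 2) ^ n))"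
  proof (rule suminf_le)
    fix n
    have "(\<integral>\<^sup>+x. ennreal (D n x) \<partial>M) = ennreal (4 ^ n) * (\<integral>\<^sup>+x. ennreal ((f n x - f (Suc n) x)\<^sup>2) \<partial>M)"
      unfolding D_def by (subst nn_integral_cmult[symmetric]) (auto simp: ennreal_mult)
    also have "\<dots> \<le> ennreal (4 ^ n) * ennreal ((1 / 8) ^ n)"
      by (intro mult_left_mono le) simp
    also have "\<dots> = ennreal ((1 / 2) ^ n)"
      by (subst ennreal_mult[symmetric]) (auto simp: power_mult_distrib[symmetric])
    finally show "(\<integral>\<^sup>+x. ennreal (D n x) \<partial>M) \<le> ennreal ((1 / 2) ^ n)" .
  qed auto
  also have "\<dots> = ennreal (\<Sum>n. (1 / 2) ^ n)"
    by (rule suminf_ennreal2) (auto intro: summable_geometric)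
  also have "\<dots> < \<infinity>" by simp
  finally have "(\<integral>\<^sup>+x. (\<Sum>n. ennreal (D n x)) \<partial>M) \<noteq> \<infinity>" by simp
  then have "AE x in M. (\<Sum>n. ennreal (D n x)) \<noteq> \<infinity>"
    by (intro nn_integral_PInf_AE) measurable
  then show ?thesis
  proof eventually_elim
    case (elim x)
    then obtain C where C: "(\<Sum>n. ennreal (D n x)) = ennreal C" "C \<ge> 0"
      by (cases "\<Sum>n. ennreal (D n x)") auto
    have "norm (f (Suc n) x - f n x) \<le> sqrt C * (1 / 2) ^ n" for n
    proof -
      have "ennreal (D n x) \<le> ennreal C"
        using sum_le_suminf[of "\<lambda>n. ennreal (D n x)" "{n}"] C by simp
      then have "D n x \<le> C" using C(2) by simp
      then have "sqrt (D n x) \<le> sqrt C" by simp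
      moreover have "sqrt (D n x) = 2 ^ n * \<bar>f n x - f (Suc n) x\<bar>"
      proof -
        have "D n x = (2 ^ n * (f n x - f (Suc n) x))\<^sup>2"
          by (simp add: D_def power_mult_distrib power2_eq_square[of "2 ^ n"] power_mult_distrib[symmetric])
        then show ?thesis by (simp add: abs_mult)
      qed
      ultimately show ?thesis by (simp add: field_simps power_divide abs_minus_commute)
    qed
    moreover have "summable (\<lambda>n. sqrt C * (1 / 2) ^ n)"
      by (rule summable_mult[OF summable_geometric]) simp
    ultimately have "summable (\<lambda>n. f (Suc n) x - f n x)"
      by (rule summable_comparison_test'[of _ 0, rotated])
    then have "convergent (\<lambda>n. \<Sum>i<n. f (Suc i) x - f i x)" by (simp add: summable_iff_convergent)
    then have "convergent (\<lambda>n. f n x - f 0 x)" by (simp only: sum_lessThan_telescope[of "\<lambda>n. f n x"])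
    from convergent_add[OF this convergent_const[of "f 0 x"]] show ?case by simp
  qed
qed

text \<open>Compactness of the product of copies of [-1, 1]. A filter takes the place of a
  subsequence, because such a product need not be sequentially compact.\<close>

lemma pointwise_cluster_point:
  fixes f :: "nat \<Rightarrow> 'a \<Rightarrow> real"
  assumes "\<And>n x. \<bar>f n x\<bar> \<le> 1"
  obtains F g where "F \<noteq> bot" "F \<le> filtermap f sequentially" "\<And>x. ((\<lambda>h. h x) \<longlongrightarrow> g x) F"
proof -
  define C where "C = (\<Pi>\<^sub>E x\<in>(UNIV :: 'a set). {-1..(1::real)})"
  have "compact C" unfolding C_def compactin_euclidean_iff[symmetric] euclidean_product_topology[symmetric]
    by (subst compactin_PiE) auto
  moreover have "eventually (\<lambda>h. h \<in> C) (filtermap f sequentially)"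
    using assms by (auto simp: eventually_filtermap C_def abs_le_iff intro!: always_eventually)
  moreover have "filtermap f sequentially \<noteq> bot" by (simp add: filtermap_bot_iff)
  ultimately obtain g where g: "inf (nhds g) (filtermap f sequentially) \<noteq> bot"
    unfolding compact_filter by blast
  have "((\<lambda>h. h x) \<longlongrightarrow> g x) (inf (nhds g) (filtermap f sequentially))" for x
  proof -
    have "((\<lambda>h. h x) \<longlongrightarrow> g x) (nhds g)"
    proof -
      have "((\<lambda>h. h x) \<longlongrightarrow> (\<lambda>h. h x) g) (at g)"
        using continuous_on_product_coordinates[of x] unfolding continuous_on_def by blast
      then show ?thesis by (subst (asm) tendsto_at_iff_tendsto_nhds)
    qed
    then show ?thesis by (rule filterlim_mono) auto
  qed
  with g show ?thesis by (intro that) auto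
qed

lemma
  fixes F :: "'g \<Rightarrow> 'a \<Rightarrow> real"
  assumes "\<And>s. integrable M (F s)"
  shows integrable_wsum: "integrable M (\<lambda>x. wsum ys (\<lambda>s. F s x))"
    and integral_wsum: "(\<integral>x. wsum ys (\<lambda>s. F s x) \<partial>M) = wsum ys (\<lambda>s. \<integral>x. F s x \<partial>M)"
proof (induction ys)
  case (Cons p ys)
  case 1 show ?case using Cons assms by (cases p) simp
  case 2 show ?case using Cons assms by (cases p) simp
qed auto


section \<open>The extremal problem for functions on the group\<close>

lemma image_plus_eq_vimage: "(\<lambda>x. s + x) ` A = (\<lambda>x. - s + x) -` A" for s :: "'g::group_add"
proof (intro set_eqI iffI)
  fix x assume "x \<in> (\<lambda>x. - s + x) -` A"
  then show "x \<in> (\<lambda>x. s + x) ` A" by (intro image_eqI[of _ _ "- s + x"]) (simp_all add: add.assoc[symmetric])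
qed (auto simp: add.assoc[symmetric])

text \<open>The sigma-algebra of \<open>nu\<close> may contain right K-invariant sets only, hence
  the invariance in \<open>open_sets\<close>. The last assumption is a one-sided continuity of
  translation in L1 for the set whose indicator dominates all candidates.\<close>

locale delsarte_problem =
  fixes nu :: "'g::topological_group_add measure" and K U V :: "'g set"
  assumes space_nu: "space nu = UNIV"
    and translate_measurable: "\<And>s. (\<lambda>x. s + x) \<in> nu \<rightarrow>\<^sub>M nu"
    and translate_invariant: "\<And>s. distr nu nu (\<lambda>x. s + x) = nu"
    and open_sets: "\<And>A. open A \<Longrightarrow> (\<And>x k. x \<in> A \<Longrightarrow> k \<in> K \<Longrightarrow> x + k \<in> A) \<Longrightarrow> A \<in> sets nu"
    and interior_U: "\<And>x k. x \<in> interior U \<Longrightarrow> k \<in> K \<Longrightarrow> x + k \<in> interior U"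
      "emeasure nu (interior U) < \<infinity>"
    and closed_U: "closed U" and closed_V: "closed V"
    and translate_continuous: "\<And>e. e > 0 \<Longrightarrow> \<exists>N. open N \<and> 0 \<in> N \<and>
        (\<forall>s\<in>N. measure nu ((\<lambda>x. s + x) ` interior U - interior U) < e)"
begin

text \<open>The functions \<open>x \<mapsto> \<Phi> K (x +o K)\<close> of the kernels in the class.
  As \<open>U\<close> and \<open>V\<close> are closed, sign conditions express the conditions on
  supports.\<close>

definition adm :: "('g \<Rightarrow> real) set" where
  "adm = {f. pos_def f \<and> f 0 = 1 \<and> continuous_on UNIV f \<and> (\<forall>x. \<forall>k\<in>K. f (x + k) = f x) \<and>
     (\<forall>x. 0 < f x \<longrightarrow> x \<in> U) \<and> (\<forall>x. f x < 0 \<longrightarrow> x \<in> V)}"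

abbreviation u :: "'g \<Rightarrow> real" where "u \<equiv> indicator (interior U)"

lemma sets_U [measurable]: "interior U \<in> sets nu"
  using interior_U(1) by (intro open_sets) auto

lemma integrable_u: "integrable nu u"
  using interior_U(2) by (simp add: integrable_indicator_iff)

lemma integral_translate:
  fixes f :: "'g \<Rightarrow> real"
  assumes "f \<in> borel_measurable nu"
  shows "(\<integral>x. f (s + x) \<partial>nu) = (\<integral>x. f x \<partial>nu)"
  using integral_distr[OF translate_measurable assms] translate_invariant by simp

lemma integrable_translate:
  fixes f :: "'g \<Rightarrow> real"
  assumes "integrable nu f"
  shows "integrable nu (\<lambda>x. f (s + x))"
  using integrable_distr[of "\<lambda>x. s + x" nu nu f] translate_measurable translate_invariant assms by simp

lemma AE_translate:
  assumes "AE x in nu. P x"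
  shows "AE x in nu. P (s + x)"
proof -
  from assms obtain N where N: "{x \<in> space nu. \<not> P x} \<subseteq> N" "N \<in> null_sets nu"
    by (auto elim: AE_E3 simp: eventually_ae_filter)
  from N(2) have "N \<in> null_sets (distr nu nu (\<lambda>x. s + x))" by (simp add: translate_invariant)
  then have "(\<lambda>x. s + x) -` N \<inter> space nu \<in> null_sets nu"
    using translate_measurable by (simp add: null_sets_distr_iff)
  then show ?thesis by (rule AE_I') (use N(1) in \<open>auto simp: space_nu\<close>)
qed

lemma measurable_continuous:
  fixes f :: "'g \<Rightarrow> real"
  assumes f: "continuous_on UNIV f" "\<And>x k. k \<in> K \<Longrightarrow> f (x + k) = f x"
  shows "f \<in> borel_measurable nu"
proof (rule borel_measurableI)
  fix S :: "real set" assume "open S"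
  then have "open (f -` S)" using f(1) by (simp add: open_vimage)
  then have "f -` S \<in> sets nu" using f(2) by (intro open_sets) auto
  then show "f -` S \<inter> space nu \<in> sets nu" by (simp add: space_nu)
qed

text \<open>The set where \<open>f\<close> is positive is open and lies in \<open>U\<close>, hence
  in its interior, and \<open>f \<le> f 0 = 1\<close>. Thus \<open>u\<close> is an integrable
  majorant common to all candidates.\<close>

lemma adm_le_u:
  assumes "f \<in> adm" shows "f x \<le> u x"
proof (cases "0 < f x")
  case True
  have "open {x. 0 < f x}" using assms by (auto simp: adm_def intro: open_Collect_less)
  moreover have "{x. 0 < f x} \<subseteq> U" using assms by (auto simp: adm_def)
  ultimately have "x \<in> interior U" using True by (intro interiorI[of "{x. 0 < f x}"]) auto
  moreover have "f x \<le> 1" using pos_def_le[of f x] assms by (simp add: adm_def abs_le_iff)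
  ultimately show ?thesis by simp
qed (auto simp: indicator_def)

lemma adm_abs_le_1: assumes "f \<in> adm" shows "\<bar>f x\<bar> \<le> 1"
  using pos_def_le[of f x] assms by (simp add: adm_def)

lemma adm_measurable: "f \<in> adm \<Longrightarrow> f \<in> borel_measurable nu"
  by (rule measurable_continuous) (auto simp: adm_def)

lemma adm_mid:
  assumes "f \<in> adm" "g \<in> adm" shows "(\<lambda>x. 1/2 * (f x + g x)) \<in> adm"
proof -
  have "pos_def (\<lambda>x. 1/2 * (f x + g x))"
    using assms by (intro pos_def_scale pos_def_add) (auto simp: adm_def)
  moreover have "x \<in> U" if "0 < 1/2 * (f x + g x)" for x
    using assms that by (cases "0 < f x"; cases "0 < g x") (auto simp: adm_def)
  moreover have "x \<in> V" if "1/2 * (f x + g x) < 0" for x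
    using assms that by (cases "f x < 0"; cases "g x < 0") (auto simp: adm_def)
  ultimately show ?thesis using assms unfolding adm_def by (auto intro!: continuous_intros)
qed

lemma adm_integral_le:
  assumes "f \<in> adm" "integrable nu f"
  shows "(\<integral>x. f x \<partial>nu) \<le> measure nu (interior U)"
proof -
  have "(\<integral>x. f x \<partial>nu) \<le> (\<integral>x. u x \<partial>nu)"
    using assms integrable_u adm_le_u by (intro integral_mono) auto
  then show ?thesis by (simp add: space_nu)
qed

lemma adm_mult_integrable:
  assumes f: "f \<in> adm" "integrable nu f" and g: "g \<in> adm"
  shows "integrable nu (\<lambda>x. f x * g x)"
proof (rule Bochner_Integration.integrable_bound[OF f(2)])
  show "(\<lambda>x. f x * g x) \<in> borel_measurable nu"
    using adm_measurable[OF f(1)] adm_measurable[OF g] by simp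
  have "\<bar>f x\<bar> * \<bar>g x\<bar> \<le> \<bar>f x\<bar>" for x
    using mult_left_mono[OF adm_abs_le_1[OF g, of x], of "\<bar>f x\<bar>"] by simp
  then show "AE x in nu. norm (f x * g x) \<le> norm (f x)" by (simp add: abs_mult)
qed

text \<open>For values in [-1, 1] the square is at most the absolute value, which is twice the
  positive part minus \<open>f\<close>. A lower bound on the integral therefore bounds the norm in
  L2.\<close>

lemma adm_square_le:
  assumes f: "f \<in> adm" "integrable nu f"
  shows "(\<integral>x. (f x)\<^sup>2 \<partial>nu) \<le> 2 * measure nu (interior U) - (\<integral>x. f x \<partial>nu)"
proof -
  have "(f x)\<^sup>2 \<le> 2 * u x - f x" for x
  proof -
    have "(f x)\<^sup>2 \<le> \<bar>f x\<bar>"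
      using mult_left_mono[OF adm_abs_le_1[OF f(1), of x], of "\<bar>f x\<bar>"] by (simp add: power2_eq_square)
    moreover have "\<bar>f x\<bar> \<le> 2 * u x - f x"
      using adm_le_u[OF f(1), of x] by (cases "0 \<le> f x") (auto simp: indicator_def)
    ultimately show ?thesis by linarith
  qed
  moreover have "integrable nu (\<lambda>x. (f x)\<^sup>2)"
    using adm_mult_integrable[OF f f(1)] by (simp add: power2_eq_square)
  ultimately have "(\<integral>x. (f x)\<^sup>2 \<partial>nu) \<le> (\<integral>x. 2 * u x - f x \<partial>nu)"
    using integrable_u f(2) by (intro integral_mono) auto
  also have "\<dots> = 2 * measure nu (interior U) - (\<integral>x. f x \<partial>nu)"
    using integrable_u f(2) by (simp add: space_nu)
  finally show ?thesis .
qed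

text \<open>Restricting to integrable functions makes this a real number as soon as one exists; an
  admissible function that is not integrable has extended integral -\<infinity>.\<close>

definition best :: real where
  "best = (SUP f\<in>{f \<in> adm. integrable nu f}. \<integral>x. f x \<partial>nu)"

lemma best_upper:
  assumes "f \<in> adm" "integrable nu f" shows "(\<integral>x. f x \<partial>nu) \<le> best"
  unfolding best_def using assms adm_integral_le
  by (intro cSUP_upper bdd_aboveI[of _ "measure nu (interior U)"]) auto

lemma maximising_sequence:
  assumes ne: "f0 \<in> adm" "integrable nu f0"
  obtains f where "\<And>n::nat. f n \<in> adm" "\<And>n. integrable nu (f n)"
    "\<And>n. best - inverse (real (Suc n)) \<le> (\<integral>x. f n x \<partial>nu)"
    "AE x in nu. convergent (\<lambda>n. f n x)"
proof -
  define I where "I f = (\<integral>x. f x \<partial>nu)" for f :: "'g \<Rightarrow> real"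
  define q where "q f = (\<integral>x. (f x)\<^sup>2 \<partial>nu)" for f :: "'g \<Rightarrow> real"
  define d where "d f g = (\<integral>x. (f x - g x)\<^sup>2 \<partial>nu)" for f g :: "'g \<Rightarrow> real"
  define A where "A e = {f \<in> adm. integrable nu f \<and> best - e < I f}" for e
  define F where "F = A ` {0<..1}"
  have AF: "A e \<in> F" if "0 < e" "e \<le> 1" for e using that by (auto simp: F_def)
  have A_mono: "A e \<subseteq> A e'" if "e \<le> e'" for e e' using that by (auto simp: A_def)
  have ne': "\<exists>f. f \<in> A e" if "e > 0" for e
  proof -
    have "best - e < (SUP f\<in>{f \<in> adm. integrable nu f}. I f)" using that by (simp add: best_def I_def)
    moreover have "bdd_above (I ` {f \<in> adm. integrable nu f})"
      using adm_integral_le by (auto simp: I_def intro!: bdd_aboveI[of _ "measure nu (interior U)"])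
    ultimately show ?thesis using ne by (subst (asm) less_cSUP_iff) (auto simp: A_def)
  qed
  obtain m where m1: "\<And>B e. B \<in> F \<Longrightarrow> e > 0 \<Longrightarrow> \<exists>x\<in>B. q x < m + e"
    and m2: "\<And>e. e > 0 \<Longrightarrow> \<exists>B\<in>F. \<forall>x\<in>B. \<forall>y\<in>B. q x < m + e \<longrightarrow> q y < m + e \<longrightarrow> d x y \<le> 8 * e"
  \<comment> \<open>All sets in \<open>F\<close> have \<open>e \<le> 1\<close>, so their members
    have integral above \<open>best - 1\<close>; \<open>adm_square_le\<close> turns this into the
    bound on \<open>q\<close>.\<close>
  proof (rule near_minimal[of F q "2 * measure nu (interior U) - (best - 1)" d])
    show "F \<noteq> {}" unfolding F_def by (auto intro!: exI[of _ 1])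
    show "0 \<le> q f" for f unfolding q_def by (rule integral_nonneg_AE) simp
    show "\<exists>f\<in>B. q f \<le> 2 * measure nu (interior U) - (best - 1)" if B: "B \<in> F" for B
    proof -
      obtain e where e: "0 < e" "e \<le> 1" "B = A e"
        using B by (auto simp: F_def)
      obtain f where f: "f \<in> A e" using ne'[OF e(1)] by blast
      then have "q f \<le> 2 * measure nu (interior U) - I f"
        unfolding q_def I_def by (intro adm_square_le) (auto simp: A_def)
      then show ?thesis using f e by (intro bexI[of _ f]) (auto simp: A_def)
    qed
    show "\<exists>h\<in>B. q h \<le> (q f + q g) / 2 - d f g / 4" if B: "B \<in> F" and fg: "f \<in> B" "g \<in> B" for B f g
    proof -
      obtain e where e: "B = A e" using B by (auto simp: F_def)
      have f: "f \<in> adm" "integrable nu f" "best - e < I f" and g: "g \<in> adm" "integrable nu g" "best - e < I g"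
        using fg by (auto simp: e A_def)
      define h where "h x = 1/2 * (f x + g x)" for x
      have "I h = 1/2 * (I f + I g)" unfolding h_def I_def using f g by simp
      then have "h \<in> B" using f g adm_mid[OF f(1) g(1)] unfolding e A_def h_def by auto
      have ff: "integrable nu (\<lambda>x. (f x)\<^sup>2)" and gg: "integrable nu (\<lambda>x. (g x)\<^sup>2)"
        and fgi: "integrable nu (\<lambda>x. f x * g x)"
        using adm_mult_integrable f g by (auto simp: power2_eq_square)
      have "q h = (\<integral>x. 1/4 * (f x)\<^sup>2 + 1/2 * (f x * g x) + 1/4 * (g x)\<^sup>2 \<partial>nu)"
        unfolding q_def h_def by (rule Bochner_Integration.integral_cong) (auto simp: power2_eq_square algebra_simps)
      also have "\<dots> = 1/4 * q f + 1/2 * (\<integral>x. f x * g x \<partial>nu) + 1/4 * q g"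
        unfolding q_def using ff gg fgi by simp
      finally have qh: "q h = 1/4 * q f + 1/2 * (\<integral>x. f x * g x \<partial>nu) + 1/4 * q g" .
      have "d f g = (\<integral>x. (f x)\<^sup>2 - 2 * (f x * g x) + (g x)\<^sup>2 \<partial>nu)"
        unfolding d_def by (rule Bochner_Integration.integral_cong) (auto simp: power2_eq_square algebra_simps)
      also have "\<dots> = q f - 2 * (\<integral>x. f x * g x \<partial>nu) + q g"
        unfolding q_def using ff gg fgi by simp
      finally have "q h = (q f + q g) / 2 - d f g / 4" using qh by (simp add: field_simps)
      with \<open>h \<in> B\<close> show ?thesis by force
    qed
  qed auto
  \<comment> \<open>Chosen so that \<open>8 * r n\<close> is the rate \<open>(1 / 8) ^ n\<close>
    that \<open>AE_convergent_of_L2_summable\<close> expects.\<close>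
  define r :: "nat \<Rightarrow> real" where "r n = (1 / 8) ^ Suc n" for n
  have r: "r n > 0" for n by (simp add: r_def)
  have r_mono: "r j \<le> r i" if "i \<le> j" for i j using that by (simp add: r_def power_decreasing)
  have "\<exists>e>0. e \<le> 1 \<and> (\<forall>x\<in>A e. \<forall>y\<in>A e. q x < m + r n \<longrightarrow> q y < m + r n \<longrightarrow> d x y \<le> 8 * r n)" for n
    using m2[OF r, of n] unfolding F_def by auto
  then obtain e where e: "\<And>n. e n > 0" "\<And>n. e n \<le> 1"
    "\<And>n x y. x \<in> A (e n) \<Longrightarrow> y \<in> A (e n) \<Longrightarrow> q x < m + r n \<Longrightarrow> q y < m + r n \<Longrightarrow> d x y \<le> 8 * r n"
    by metis
  \<comment> \<open>The minimum over \<open>e 0\<close> to \<open>e n\<close> puts both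
    \<open>f n\<close> and \<open>f (Suc n)\<close> into \<open>A (e n)\<close>; the additional
    entry makes the sequence maximising.\<close>
  define e' where "e' n = Min (insert (inverse (real (Suc n))) (e ` {..n}))" for n
  have e'0: "e' n > 0" for n unfolding e'_def using e(1) by (subst Min_gr_iff) auto
  have e'_le: "e' n \<le> e i" if "i \<le> n" for n i unfolding e'_def using that by (intro Min_le) auto
  have e'_r: "e' n \<le> inverse (real (Suc n))" for n unfolding e'_def by (intro Min_le) auto
  have e'1: "e' n \<le> 1" for n using e'_le[of n n] e(2)[of n] by simp
  have "\<exists>f. f \<in> A (e' n) \<and> q f < m + r n" for n
    using m1[OF AF[OF e'0 e'1] r] by blast
  then obtain f where f: "\<And>n. f n \<in> A (e' n)" "\<And>n. q (f n) < m + r n" by metis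
  have "d (f n) (f (Suc n)) \<le> (1 / 8) ^ n" for n
  proof -
    have "f n \<in> A (e n)" "f (Suc n) \<in> A (e n)"
      using f(1)[of n] f(1)[of "Suc n"] A_mono[OF e'_le[of n n]] A_mono[OF e'_le[of n "Suc n"]] by auto
    moreover have "q (f (Suc n)) < m + r n" using f(2)[of "Suc n"] r_mono[of n "Suc n"] by simp
    ultimately have "d (f n) (f (Suc n)) \<le> 8 * r n" using f(2) by (intro e(3)) auto
    then show ?thesis by (simp add: r_def)
  qed
  moreover have fa: "f n \<in> adm" "integrable nu (f n)" "best - e' n < I (f n)" for n
    using f(1)[of n] by (auto simp: A_def)
  ultimately have "AE x in nu. convergent (\<lambda>n. f n x)"
  proof (intro AE_convergent_of_L2_summable)
    fix n
    have int: "integrable nu (\<lambda>x. (f n x - f (Suc n) x)\<^sup>2)"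
    proof -
      have "integrable nu (\<lambda>x. f n x * f n x - 2 * (f n x * f (Suc n) x) + f (Suc n) x * f (Suc n) x)"
        using fa adm_mult_integrable by simp
      then show ?thesis by (simp add: power2_eq_square algebra_simps)
    qed
    assume *: "\<And>n. d (f n) (f (Suc n)) \<le> (1 / 8) ^ n"
    have "(\<integral>\<^sup>+x. ennreal ((f n x - f (Suc n) x)\<^sup>2) \<partial>nu) = ennreal (d (f n) (f (Suc n)))"
      unfolding d_def by (rule nn_integral_eq_integral[OF int]) simp
    also have "\<dots> \<le> ennreal ((1 / 8) ^ n)" using * by (rule ennreal_leI)
    finally show "(\<integral>\<^sup>+x. ennreal ((f n x - f (Suc n) x)\<^sup>2) \<partial>nu) \<le> ennreal ((1 / 8) ^ n)" .
  qed (auto simp: adm_measurable)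
  moreover have "best - inverse (real (Suc n)) \<le> (\<integral>x. f n x \<partial>nu)" for n
    using fa(3)[of n] e'_r[of n] unfolding I_def by linarith
  ultimately show ?thesis using fa that by blast
qed

text \<open>
  The pointwise cluster point \<open>f\<close> is positive definite everywhere but need not be measurable; it
  agrees almost everywhere with the measurable limit \<open>g\<close>.
\<close>

lemma weak_maximiser:
  assumes ne: "f0 \<in> adm" "integrable nu f0"
  obtains f g where "pos_def f" "f 0 = 1" "\<And>x k. k \<in> K \<Longrightarrow> f (x + k) = f x"
    "\<And>x. f x \<le> u x" "\<And>x. f x < 0 \<Longrightarrow> x \<in> V"
    "AE x in nu. f x = g x" "integrable nu g" "best \<le> (\<integral>x. g x \<partial>nu)"
proof -
  obtain f where f: "\<And>n::nat. f n \<in> adm" "\<And>n. integrable nu (f n)"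
    "\<And>n. best - inverse (real (Suc n)) \<le> (\<integral>x. f n x \<partial>nu)"
    "AE x in nu. convergent (\<lambda>n. f n x)"
    by (rule maximising_sequence[OF ne]) blast
  have [measurable]: "f n \<in> borel_measurable nu" for n by (rule adm_measurable[OF f(1)])
  \<comment> \<open>Where the sequence diverges, \<open>lim\<close> has an unspecified value;
    \<open>g\<close> is measurable all the same.\<close>
  define g where "g x = lim (\<lambda>n. f n x)" for x
  have [measurable]: "g \<in> borel_measurable nu" unfolding g_def by measurable
  have g: "AE x in nu. (\<lambda>n. f n x) \<longlonglongrightarrow> g x"
    using f(4) by eventually_elim (simp add: g_def convergent_LIMSEQ_iff)
  obtain F fw where F: "F \<noteq> bot" "F \<le> filtermap f sequentially" and fw: "\<And>x. ((\<lambda>h. h x) \<longlongrightarrow> fw x) F"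
    by (rule pointwise_cluster_point[of f, OF adm_abs_le_1[OF f(1)]]) blast
  \<comment> \<open>\<open>F\<close> refines the filter of the sequence, so whatever holds for all
    admissible functions holds eventually along \<open>F\<close>.\<close>
  have ev: "\<forall>\<^sub>F h in F. P h" if "\<And>h. h \<in> adm \<Longrightarrow> P h" for P
    using F(2) by (rule filter_leD) (use f(1) that in \<open>simp add: eventually_filtermap\<close>)
  have ev_le: "fw x \<le> c" if "\<And>h. h \<in> adm \<Longrightarrow> h x \<le> c" for x c
    using fw F(1) ev[OF that] by (intro tendsto_upperbound[of "\<lambda>h. h x"]) auto
  have ev_ge: "c \<le> fw x" if "\<And>h. h \<in> adm \<Longrightarrow> c \<le> h x" for x c
    using fw F(1) ev[OF that] by (intro tendsto_lowerbound[of "\<lambda>h. h x"]) auto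
  have "pos_def fw"
    by (rule pos_def_limit[OF F(1) _ fw]) (rule ev, simp add: adm_def)
  moreover have "fw 0 = 1"
    using ev_le[of 0 1] ev_ge[of 1 0] by (simp add: adm_def)
  moreover have "fw (x + k) = fw x" if "k \<in> K" for x k
  proof -
    have "\<forall>\<^sub>F h in F. h (x + k) = h x" using that by (intro ev) (simp add: adm_def)
    from tendsto_cong[OF this, THEN iffD1, OF fw] show ?thesis using fw F(1) tendsto_unique by blast
  qed
  moreover have "fw x \<le> u x" for x using adm_le_u by (rule ev_le)
  moreover have "x \<in> V" if "fw x < 0" for x
  proof (rule ccontr)
    assume "x \<notin> V"
    then have "0 \<le> fw x" by (intro ev_ge) (auto simp: adm_def not_less[symmetric])
    with that show False by simp
  qed
  moreover have "AE x in nu. fw x = g x"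
    using g
  proof eventually_elim
    case (elim x)
    have "((\<lambda>h. h x) \<longlongrightarrow> g x) (filtermap f sequentially)"
      using elim by (simp add: filterlim_filtermap)
    then have "((\<lambda>h. h x) \<longlongrightarrow> g x) F" using F(2) by (rule tendsto_mono[rotated])
    then show ?case using fw F(1) tendsto_unique by blast
  qed
  moreover have "integrable nu (\<lambda>x. u x - g x) \<and> (\<integral>x. u x - g x \<partial>nu) \<le> measure nu (interior U) - best"
  proof (rule integral_Fatou[where f = "\<lambda>n x. u x - f n x"])
    show "integrable nu (\<lambda>x. u x - f n x)" for n using integrable_u f(2) by simp
    show "AE x in nu. 0 \<le> u x - f n x" for n using adm_le_u[OF f(1)] by simp
    show "AE x in nu. (\<lambda>n. u x - f n x) \<longlonglongrightarrow> u x - g x"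
      using g by eventually_elim (intro tendsto_intros)
    show "(\<integral>x. u x - f n x \<partial>nu) \<le> measure nu (interior U) - best + inverse (real (Suc n))" for n
      using integrable_u f(2) f(3)[of n] by (simp add: space_nu)
    show "(\<lambda>n. measure nu (interior U) - best + inverse (real (Suc n))) \<longlonglongrightarrow> measure nu (interior U) - best"
      using tendsto_add[OF tendsto_const LIMSEQ_inverse_real_of_nat] by simp
  qed measurable
  then have "integrable nu g" "best \<le> (\<integral>x. g x \<partial>nu)"
  proof -
    assume *: "integrable nu (\<lambda>x. u x - g x) \<and> (\<integral>x. u x - g x \<partial>nu) \<le> measure nu (interior U) - best"
    with Bochner_Integration.integrable_diff[OF integrable_u, of "\<lambda>x. u x - g x"]
    show "integrable nu g" by simp
    with * integrable_u show "best \<le> (\<integral>x. g x \<partial>nu)" by (simp add: space_nu)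
  qed
  ultimately show ?thesis by (rule that)
qed

text \<open>Averages of \<open>f\<close> are dominated by averages of translates of
  \<open>u\<close>, not by \<open>u\<close> itself, which obstructs a direct use of Fatou's lemma.
  The excess lives on the sets \<open>D s\<close>, whose measure tends to 0 as the averages
  concentrate at 0. Inequalities pass from \<open>f\<close> to \<open>h\<close> by \<open>le\<close>
  and \<open>ge\<close>.\<close>

lemma maximiser_exists:
  assumes ne: "f0 \<in> adm" "integrable nu f0" "0 < (\<integral>x. f0 x \<partial>nu)"
  obtains h where "h \<in> adm" "integrable nu h"
    "\<And>f. f \<in> adm \<Longrightarrow> integrable nu f \<Longrightarrow> (\<integral>x. f x \<partial>nu) \<le> (\<integral>x. h x \<partial>nu)"
proof -
  obtain f g where f: "pos_def f" "f 0 = 1" "\<And>x k. k \<in> K \<Longrightarrow> f (x + k) = f x"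
    "\<And>x. f x \<le> u x" "\<And>x. f x < 0 \<Longrightarrow> x \<in> V"
    and fg: "AE x in nu. f x = g x" and g: "integrable nu g" "best \<le> (\<integral>x. g x \<partial>nu)"
    by (rule weak_maximiser[OF ne(1,2)]) blast
  obtain h where h: "pos_def h" "continuous_on UNIV h"
    and approx: "\<And>N e. open N \<Longrightarrow> 0 \<in> N \<Longrightarrow> e > 0 \<Longrightarrow>
       \<exists>xs. prob_list N xs \<and> (\<forall>x. \<bar>wsum xs (\<lambda>s. f (- s + x)) - h x\<bar> \<le> e)"
    using continuous_part[of f] f(1,2) by auto
  \<comment> \<open>The averages use left translations, which commute with right translations by
    \<open>K\<close>.\<close>
  have inv: "h (x + k) = h x" if k: "k \<in> K" for x k
  proof -
    have "\<bar>h (x + k) - h x\<bar> \<le> e" if e: "e > 0" for e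
    proof -
      obtain xs where xs: "\<And>x. \<bar>wsum xs (\<lambda>s. f (- s + x)) - h x\<bar> \<le> e / 2"
        using approx[of UNIV "e / 2"] e by auto
      have "wsum xs (\<lambda>s. f (- s + (x + k))) = wsum xs (\<lambda>s. f (- s + x))"
        using f(3)[OF k] by (simp only: add.assoc[symmetric])
      then show ?thesis using xs[of x] xs[of "x + k"] by linarith
    qed
    then have "\<bar>h (x + k) - h x\<bar> \<le> 0" by (rule field_le_epsilon[of _ 0, simplified])
    then show ?thesis by simp
  qed
  have le: "h x \<le> c" if N: "open N" "0 \<in> N" and le: "\<And>s. s \<in> N \<Longrightarrow> f (- s + x) \<le> c" for N x c
  proof (rule field_le_epsilon)
    fix e :: real assume "e > 0"
    with approx N obtain xs where xs: "prob_list N xs" "\<bar>wsum xs (\<lambda>s. f (- s + x)) - h x\<bar> \<le> e" by blast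
    have "wsum xs (\<lambda>s. f (- s + x)) \<le> c" by (rule wsum_le[OF xs(1) le])
    then show "h x \<le> c + e" using xs(2) by linarith
  qed
  have ge: "c \<le> h x" if N: "open N" "0 \<in> N" and ge: "\<And>s. s \<in> N \<Longrightarrow> c \<le> f (- s + x)" for N x c
  proof (rule field_le_epsilon)
    fix e :: real assume "e > 0"
    with approx N obtain xs where xs: "prob_list N xs" "\<bar>wsum xs (\<lambda>s. f (- s + x)) - h x\<bar> \<le> e" by blast
    have "c \<le> wsum xs (\<lambda>s. f (- s + x))" by (rule wsum_ge[OF xs(1) ge])
    then show "c \<le> h x + e" using xs(2) by linarith
  qed
  have pull: "open ((\<lambda>s. - s + x) -` S)" if "open S" for S and x :: 'g
    using that by (intro open_vimage continuous_intros)
  \<comment> \<open>\<open>U\<close> is closed, so for \<open>x\<close> outside \<open>U\<close> all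
    sufficiently small translates stay outside, where \<open>f \<le> u = 0\<close>.\<close>
  have h_U: "x \<in> U" if "0 < h x" for x
  proof (rule ccontr)
    assume "x \<notin> U"
    then have "h x \<le> 0"
    proof (intro le[of "(\<lambda>s. - s + x) -` (- U)"] pull)
      show "f (- s + x) \<le> 0" if "s \<in> (\<lambda>s. - s + x) -` (- U)" for s
        using f(4)[of "- s + x"] that interior_subset[of U] by (cases "- s + x \<in> interior U") auto
    qed (use closed_U in \<open>auto intro: open_Compl\<close>)
    with that show False by simp
  qed
  have h_V: "x \<in> V" if "h x < 0" for x
  proof (rule ccontr)
    assume "x \<notin> V"
    then have "0 \<le> h x"
    proof (intro ge[of "(\<lambda>s. - s + x) -` (- V)"] pull)
      show "0 \<le> f (- s + x)" if "s \<in> (\<lambda>s. - s + x) -` (- V)" for s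
        using f(5)[of "- s + x"] that by (auto simp: not_less[symmetric])
    qed (use closed_V in \<open>auto intro: open_Compl\<close>)
    with that show False by simp
  qed
  have h1: "h x \<le> 1" for x
    by (rule le[of UNIV]) (auto intro: order_trans[OF f(4)] indicator_le_1)
  have h_u: "h x \<le> u x" for x
  proof (cases "0 < h x")
    case True
    have "x \<in> interior U"
      using True h(2) h_U by (intro interiorI[of "{x. 0 < h x}"] open_Collect_less) auto
    then show ?thesis using h1 by simp
  qed (auto simp: indicator_def)
  have [measurable]: "h \<in> borel_measurable nu" using h(2) inv by (rule measurable_continuous)
  have "integrable nu (\<lambda>x. u x - h x) \<and> (\<integral>x. u x - h x \<partial>nu) \<le> measure nu (interior U) - best"
  proof -
    define r where "r n = inverse (real (Suc n))" for n
    have r: "r n > 0" for n by (simp add: r_def)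
    define D where "D s = (\<lambda>x. s + x) ` interior U - interior U" for s
    have trans_sets: "(\<lambda>x. s + x) ` interior U \<in> sets nu" for s
    proof -
      have "(\<lambda>x. s + x) ` interior U = (\<lambda>x. - s + x) -` interior U \<inter> space nu"
        by (simp add: space_nu image_plus_eq_vimage)
      then show ?thesis using measurable_sets[OF translate_measurable sets_U, of "- s"] by simp
    qed
    have "\<exists>xs. prob_list {s. measure nu (D s) \<le> r n} xs \<and> (\<forall>x. \<bar>wsum xs (\<lambda>s. f (- s + x)) - h x\<bar> \<le> r n)" for n
    proof -
      obtain N where N: "open N" "0 \<in> N" "\<And>s. s \<in> N \<Longrightarrow> measure nu (D s) < r n"
        using translate_continuous[OF r, of n] unfolding D_def by blast
      obtain xs where "prob_list N xs" "\<forall>x. \<bar>wsum xs (\<lambda>s. f (- s + x)) - h x\<bar> \<le> r n"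
        using approx[OF N(1,2) r] by blast
      moreover from this(1) have "prob_list {s. measure nu (D s) \<le> r n} xs"
        by (rule prob_list_mono) (use N(3) in \<open>auto intro: less_imp_le\<close>)
      ultimately show ?thesis by blast
    qed
    then obtain xs where xs: "\<And>n. prob_list {s. measure nu (D s) \<le> r n} (xs n)"
      "\<And>n x. \<bar>wsum (xs n) (\<lambda>s. f (- s + x)) - h x\<bar> \<le> r n" by metis
    have D_fin: "integrable nu (indicator (D s) :: 'g \<Rightarrow> real)" for s
    proof -
      have "emeasure nu ((\<lambda>x. s + x) ` interior U) = emeasure nu (interior U)"
      proof -
        have "(\<lambda>x. s + x) ` interior U = (\<lambda>x. - s + x) -` interior U \<inter> space nu"
          by (simp add: space_nu image_plus_eq_vimage)
        then have "emeasure nu ((\<lambda>x. s + x) ` interior U) = emeasure (distr nu nu (\<lambda>x. - s + x)) (interior U)"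
          using translate_measurable by (simp add: emeasure_distr)
        then show ?thesis by (simp add: translate_invariant)
      qed
      then have "emeasure nu (D s) < \<infinity>"
        using interior_U(2) trans_sets[of s] emeasure_mono[of "D s" "(\<lambda>x. s + x) ` interior U" nu]
        by (auto simp: D_def)
      then show ?thesis using trans_sets[of s] by (simp add: integrable_indicator_iff D_def)
    qed
    \<comment> \<open>Nonnegative almost everywhere: \<open>g (- s + x) \<le> u (- s + x)\<close>,
      and the translated indicator exceeds \<open>u x\<close> on \<open>D s\<close> only.\<close>
    define G where "G s x = u x - g (- s + x) + indicator (D s) x" for s x
    have G_int: "integrable nu (G s)" for s
      unfolding G_def using integrable_u integrable_translate[OF g(1)] D_fin
      by (intro Bochner_Integration.integrable_add Bochner_Integration.integrable_diff) auto
    have G_val: "(\<integral>x. G s x \<partial>nu) \<le> measure nu (interior U) - best + measure nu (D s)" for s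
    proof -
      have "(\<integral>x. G s x \<partial>nu) = (\<integral>x. u x - g (- s + x) \<partial>nu) + (\<integral>x. indicator (D s) x \<partial>nu)"
        unfolding G_def using integrable_u integrable_translate[OF g(1)] D_fin
        by (intro Bochner_Integration.integral_add Bochner_Integration.integrable_diff) auto
      also have "(\<integral>x. u x - g (- s + x) \<partial>nu) = (\<integral>x. u x \<partial>nu) - (\<integral>x. g (- s + x) \<partial>nu)"
        using integrable_u integrable_translate[OF g(1)] by (rule Bochner_Integration.integral_diff)
      also have "(\<integral>x. g (- s + x) \<partial>nu) = (\<integral>x. g x \<partial>nu)"
        using g(1) by (intro integral_translate) auto
      finally show ?thesis using g(2) by (simp add: space_nu)
    qed
    \<comment> \<open>The integrals are taken of \<open>g\<close> in place of the possibly
      non-measurable \<open>f\<close>; a finite list of translates costs only finitely many null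
      sets.\<close>
    have wsum_AE: "AE x in nu. \<forall>(s, w)\<in>set ys. f (- s + x) = g (- s + x)" for ys :: "('g \<times> real) list"
    proof (rule AE_finite_allI)
      show "AE x in nu. case p of (s, w) \<Rightarrow> f (- s + x) = g (- s + x)" for p
        using AE_translate[OF fg, of "- fst p"] by (cases p) simp
    qed simp
    \<comment> \<open>The truncation supplies the sign for Fatou's lemma. It is harmless in the
      estimate, because the average of \<open>G\<close> dominates both arguments of
      \<open>max\<close>, and in the limit, because \<open>h \<le> u\<close>.\<close>
    define A where "A n x = max 0 (u x - wsum (xs n) (\<lambda>s. g (- s + x)))" for n x
    have A_int: "integrable nu (A n)" for n
      unfolding A_def using integrable_u integrable_wsum[of nu "\<lambda>s x. g (- s + x)", OF integrable_translate[OF g(1)]]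
      by (intro integrable_max) auto
    have "integrable nu (\<lambda>x. u x - h x) \<and> (\<integral>x. u x - h x \<partial>nu) \<le> measure nu (interior U) - best"
    proof (rule integral_Fatou[of nu A])
      show "integrable nu (A n)" for n by (rule A_int)
      show "AE x in nu. 0 \<le> A n x" for n by (simp add: A_def)
      have "AE x in nu. \<forall>n. \<forall>(s, w)\<in>set (xs n). f (- s + x) = g (- s + x)"
        using wsum_AE by (simp add: AE_all_countable)
      then show "AE x in nu. (\<lambda>n. A n x) \<longlonglongrightarrow> u x - h x"
      proof eventually_elim
        case (elim x)
        have "wsum (xs n) (\<lambda>s. g (- s + x)) = wsum (xs n) (\<lambda>s. f (- s + x))" for n
          using elim by (intro wsum_cong) fastforce
        then have bd: "\<bar>wsum (xs n) (\<lambda>s. g (- s + x)) - h x\<bar> \<le> r n" for n using xs(2) by simp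
        have "(\<lambda>n. wsum (xs n) (\<lambda>s. g (- s + x)) - h x) \<longlonglongrightarrow> 0"
          by (rule tendsto_rabs_zero_cancel, rule tendsto_sandwich[OF _ _ tendsto_const LIMSEQ_inverse_real_of_nat])
            (use bd in \<open>auto simp: r_def intro!: always_eventually\<close>)
        then have "(\<lambda>n. wsum (xs n) (\<lambda>s. g (- s + x))) \<longlonglongrightarrow> h x" by (rule LIM_zero_cancel)
        then have "(\<lambda>n. A n x) \<longlonglongrightarrow> max 0 (u x - h x)"
          unfolding A_def by (intro tendsto_intros)
        then show ?case using h_u[of x] by (simp add: max_def)
      qed
      show "(\<integral>x. A n x \<partial>nu) \<le> measure nu (interior U) - best + r n" for n
      proof -
        have "(\<integral>x. A n x \<partial>nu) \<le> (\<integral>x. wsum (xs n) (\<lambda>s. G s x) \<partial>nu)"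
        proof (rule integral_mono_AE[OF A_int integrable_wsum[OF G_int]])
          show "AE x in nu. A n x \<le> wsum (xs n) (\<lambda>s. G s x)"
            using wsum_AE[of "xs n"]
          proof eventually_elim
            case (elim x)
            have ind: "u (- s + x) \<le> u x + indicator (D s) x" for s
            proof (cases "- s + x \<in> interior U")
              case True
              then have "x \<in> (\<lambda>x. s + x) ` interior U" by (simp add: image_plus_eq_vimage)
              then show ?thesis by (auto simp: D_def indicator_def)
            qed (simp add: indicator_def)
            have w: "0 \<le> w" if "(s, w) \<in> set (xs n)" for s w using xs(1)[of n] that by (auto simp: prob_list_def)
            have "wsum (xs n) (\<lambda>_. 0) \<le> wsum (xs n) (\<lambda>s. G s x)"
            proof (rule wsum_mono)
              fix s w assume sw: "(s, w) \<in> set (xs n)"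
              then have "g (- s + x) \<le> u (- s + x)" using elim f(4)[of "- s + x"] by fastforce
              then show "0 \<le> w \<and> 0 \<le> G s x" using w[OF sw] ind[of s] by (simp add: G_def)
            qed
            moreover have "wsum (xs n) (\<lambda>s. u x - g (- s + x)) \<le> wsum (xs n) (\<lambda>s. G s x)"
              using w by (intro wsum_mono) (auto simp: G_def)
            moreover have "wsum (xs n) (\<lambda>s. u x - g (- s + x)) = u x - wsum (xs n) (\<lambda>s. g (- s + x))"
              by (simp only: wsum_diff wsum_const[OF xs(1)])
            moreover have "wsum (xs n) (\<lambda>_. 0) = 0" by (rule wsum_const[OF xs(1)])
            ultimately show ?case unfolding A_def by linarith
          qed
        qed
        also have "\<dots> = wsum (xs n) (\<lambda>s. \<integral>x. G s x \<partial>nu)" by (rule integral_wsum[OF G_int])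
        also have "\<dots> \<le> measure nu (interior U) - best + r n"
        proof (rule wsum_le[OF xs(1)])
          fix s assume "s \<in> {s. measure nu (D s) \<le> r n}"
          then show "(\<integral>x. G s x \<partial>nu) \<le> measure nu (interior U) - best + r n"
            using G_val[of s] by simp
        qed
        finally show ?thesis .
      qed
      show "(\<lambda>n. measure nu (interior U) - best + r n) \<longlonglongrightarrow> measure nu (interior U) - best"
        using tendsto_add[OF tendsto_const LIMSEQ_inverse_real_of_nat] by (simp add: r_def)
    qed measurable
    then show ?thesis .
  qed
  then have uh: "integrable nu (\<lambda>x. u x - h x)" "(\<integral>x. u x - h x \<partial>nu) \<le> measure nu (interior U) - best"
    by auto
  with Bochner_Integration.integrable_diff[OF integrable_u, of "\<lambda>x. u x - h x"]
  have h_int: "integrable nu h" by simp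
  have h_best: "best \<le> (\<integral>x. h x \<partial>nu)" using uh(2) h_int integrable_u by (simp add: space_nu)
  have pos: "0 < (\<integral>x. h x \<partial>nu)" using ne(3) best_upper[OF ne(1,2)] h_best by linarith
  have h0: "0 < h 0"
  proof (rule ccontr)
    assume "\<not> 0 < h 0"
    then have "h x = 0" for x using pos_def_le[OF h(1), of x] by simp
    then have "h = (\<lambda>_. 0)" by blast
    with pos show False by simp
  qed
  define k where "k x = inverse (h 0) * h x" for x
  have "k \<in> adm"
    unfolding adm_def
  proof (intro CollectI conjI)
    show "pos_def k" unfolding k_def using h0 by (intro pos_def_scale h(1)) simp
    show "continuous_on UNIV k" unfolding k_def by (intro continuous_intros h(2))
  qed (use h0 h_U h_V inv in \<open>auto simp: k_def zero_less_mult_iff mult_less_0_iff\<close>)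
  moreover have "integrable nu k" unfolding k_def using h_int by simp
  moreover have "(\<integral>x. f x \<partial>nu) \<le> (\<integral>x. k x \<partial>nu)" if "f \<in> adm" "integrable nu f" for f
  proof -
    have "1 \<le> inverse (h 0)" using h0 h1[of 0] by (simp add: one_le_inverse)
    then have "1 * (\<integral>x. h x \<partial>nu) \<le> inverse (h 0) * (\<integral>x. h x \<partial>nu)"
      using pos by (intro mult_right_mono) auto
    then show ?thesis using best_upper[OF that] h_best by (simp add: k_def)
  qed
  ultimately show ?thesis by (rule that)
qed

end


section \<open>Measures on the coset space\<close>

definition right_invariant :: "'g::group_add set \<Rightarrow> 'g set \<Rightarrow> bool" where
  "right_invariant K A \<longleftrightarrow> (\<forall>x\<in>A. \<forall>k\<in>K. x + k \<in> A)"

lemma compact_set_plus: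
  fixes A B :: "'g::topological_monoid_add set"
  assumes "compact A" "compact B" shows "compact (A + B)"
proof -
  have "A + B = (\<lambda>p. fst p + snd p) ` (A \<times> B)" by (force simp: set_plus_def)
  moreover have "continuous_on (A \<times> B) (\<lambda>p. fst p + snd p)" by (intro continuous_intros)
  ultimately show ?thesis using assms by (simp add: compact_continuous_image compact_Times)
qed

lemma open_plus_vimage:
  fixes A :: "'g::topological_group_add set"
  assumes "open A"
  shows "open ((\<lambda>x. s + x) -` A)" "open ((\<lambda>x. x + s) -` A)" "open ((\<lambda>x. s + x) ` A)"
  unfolding image_plus_eq_vimage using assms by (auto intro!: open_vimage continuous_intros)

locale subgroup_cosets =
  fixes K :: "'g::topological_group_add set"
  assumes subgroup: "is_subgroup K"
begin

lemma K_0: "0 \<in> K" and K_minus: "x \<in> K \<Longrightarrow> - x \<in> K" and K_plus: "x \<in> K \<Longrightarrow> y \<in> K \<Longrightarrow> x + y \<in> K"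
  using subgroup by (auto simp: is_subgroup_def)

lemma mem_coset: "y \<in> x +o K \<longleftrightarrow> - x + y \<in> K"
proof
  assume "- x + y \<in> K"
  then show "y \<in> x +o K" unfolding elt_set_plus_def by (intro CollectI bexI[of _ "- x + y"]) (simp_all add: add.assoc[symmetric])
qed (auto simp: elt_set_plus_def add.assoc[symmetric])

lemma coset_self: "x \<in> x +o K" by (simp add: mem_coset K_0)

lemma coset_eq: "x +o K = y +o K \<longleftrightarrow> - x + y \<in> K"
proof
  assume "- x + y \<in> K"
  then have *: "- x + y \<in> K" "- y + x \<in> K" using K_minus[of "- x + y"] by (simp_all add: minus_add)
  have "- x + z \<in> K \<longleftrightarrow> - y + z \<in> K" for z
  proof
    assume "- x + z \<in> K"
    from K_plus[OF *(2) this] show "- y + z \<in> K" by (simp add: add.assoc)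
  next
    assume "- y + z \<in> K"
    from K_plus[OF *(1) this] show "- x + z \<in> K" by (simp add: add.assoc)
  qed
  then show "x +o K = y +o K" by (auto simp: mem_coset)
next
  assume "x +o K = y +o K"
  then have "y \<in> x +o K" using coset_self[of y] by metis
  then show "- x + y \<in> K" by (simp only: mem_coset)
qed

lemma coset_absorb: "k \<in> K \<Longrightarrow> (x + k) +o K = x +o K"
  using coset_eq[of x "x + k"] by (simp add: add.assoc[symmetric])

lemma coset_0: "0 +o K = K" by (simp add: elt_set_plus_def)

text \<open>The same choice of representative as in \<open>normalised_quotient_measure\<close>, so
  that the double integral there can be written with \<open>rep\<close>.\<close>

definition rep :: "'g set \<Rightarrow> 'g" where "rep p = (SOME g. g \<in> p)"

lemma rep_in: "- x + rep (x +o K) \<in> K"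
  unfolding rep_def mem_coset[symmetric] by (rule someI) (rule coset_self)

lemma rep_coset: "rep (x +o K) +o K = x +o K"
  using rep_in coset_eq by blast

lemma rep_coset': "p \<in> cosets K \<Longrightarrow> rep p +o K = p"
  by (auto simp: cosets_def rep_coset)

lemma rep_eq: obtains k where "k \<in> K" "rep (x +o K) = x + k"
  using rep_in[of x] by (intro that[of "- x + rep (x +o K)"]) (simp_all add: add.assoc[symmetric])

lemma vimage_image_coset:
  assumes "right_invariant K A" shows "(\<lambda>x. x +o K) -` (\<lambda>x. x +o K) ` A = A"
proof (intro equalityI subsetI)
  fix x assume "x \<in> (\<lambda>x. x +o K) -` (\<lambda>x. x +o K) ` A"
  then obtain y where y: "y \<in> A" "- y + x \<in> K" using coset_eq by fastforce
  then have "y + (- y + x) \<in> A" using assms unfolding right_invariant_def by blast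
  then show "x \<in> A" by (simp add: add.assoc[symmetric])
qed auto

lemma right_invariant_plus_K: "right_invariant K (A + K)"
  unfolding right_invariant_def set_plus_def by (force simp: add.assoc intro: K_plus)

lemma subset_plus_K: "A \<subseteq> A + K"
  unfolding set_plus_def using K_0 by force

lemma image_plus_K: "(\<lambda>x. x +o K) ` (A + K) = (\<lambda>x. x +o K) ` A"
proof
  show "(\<lambda>x. x +o K) ` (A + K) \<subseteq> (\<lambda>x. x +o K) ` A"
    by (auto simp: set_plus_def coset_absorb)
qed (use subset_plus_K in blast)

lemma right_invariant_Compl: assumes "right_invariant K A" shows "right_invariant K (- A)"
  unfolding right_invariant_def
proof (intro ballI)
  fix x k assume "x \<in> - A" and k: "k \<in> K"
  moreover have "x + k + - k = x" by (simp add: add.assoc)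
  ultimately show "x + k \<in> - A" using assms K_minus[OF k] unfolding right_invariant_def by (metis ComplD ComplI)
qed

lemma open_plus_K: assumes "open A" shows "open (A + K)"
proof -
  have "A + K = (\<Union>k\<in>K. (\<lambda>x. x + - k) -` A)"
  proof (intro equalityI subsetI)
    fix x assume "x \<in> (\<Union>k\<in>K. (\<lambda>x. x + - k) -` A)"
    then obtain k where "k \<in> K" "x + - k \<in> A" by auto
    then have "(x + - k) + k \<in> A + K" by (intro set_plus_intro) auto
    then show "x \<in> A + K" by (simp add: add.assoc)
  next
    fix x assume "x \<in> A + K"
    then obtain a k where "x = a + k" "a \<in> A" "k \<in> K" by (rule set_plus_elim)
    then show "x \<in> (\<Union>k\<in>K. (\<lambda>x. x + - k) -` A)" by (intro UN_I[of k]) (simp_all only: vimage_eq add.assoc add.right_inverse add_0_right)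
  qed
  moreover have "open (\<Union>k\<in>K. (\<lambda>x. x + - k) -` A)"
    using open_plus_vimage(2)[OF assms] by blast
  ultimately show ?thesis by simp
qed

lemma open_image_coset: assumes "open A" shows "openin (coset_topology K) ((\<lambda>x. x +o K) ` A)"
proof -
  have "(\<lambda>x. x +o K) -` (\<lambda>x. x +o K) ` A = A + K"
    using vimage_image_coset[OF right_invariant_plus_K] image_plus_K by metis
  then show ?thesis using open_plus_K[OF assms] by (auto simp: openin_coset_topology cosets_def)
qed

lemma continuous_map_coset: "continuous_map euclidean (coset_topology K) (\<lambda>x. x +o K)"
  using quotient_map_coset_topology by (rule quotient_imp_continuous_map)

lemma compactin_image_coset: "compact L \<Longrightarrow> compactin (coset_topology K) ((\<lambda>x. x +o K) ` L)"
  using image_compactin[OF _ continuous_map_coset] by simp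

lemma translate_coset: "g +o (x +o K) = (g + x) +o K"
  by (rule set_plus_rearrange2)

end

section \<open>Test functions with compact support\<close>

text \<open>The supremum of \<open>f0\<close> over the coset of \<open>x\<close> stays between
  \<open>f0 x\<close> and 1. By the tube lemma over the compact \<open>K\<close>,
  \<open>f0 (y + k)\<close> is close to \<open>f0 (x + k)\<close> uniformly in \<open>k\<close> for
  \<open>y\<close> near \<open>x\<close>, so the suprema are close too.\<close>

lemma invariant_majorant:
  fixes f0 :: "'g::{topological_group_add,t2_space} \<Rightarrow> real"
  assumes K: "is_subgroup K" "compact K" and f0: "continuous_on UNIV f0" "\<And>x. 0 \<le> f0 x" "\<And>x. f0 x \<le> 1"
    and L: "compact L" "\<And>x. f0 x \<noteq> 0 \<Longrightarrow> x \<in> L"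
  obtains f where "continuous_on UNIV f" "\<And>x. f0 x \<le> f x" "\<And>x. 0 \<le> f x" "\<And>x. f x \<le> 1"
    "\<And>x k. k \<in> K \<Longrightarrow> f (x + k) = f x" "compact (closure {x. f x \<noteq> 0})"
    "\<And>x. f x \<noteq> 0 \<Longrightarrow> \<exists>k\<in>K. f0 (x + k) \<noteq> 0"
proof -
  interpret subgroup_cosets K using K(1) by unfold_locales
  define f where "f x = (SUP y\<in>x +o K. f0 y)" for x
  have ba: "bdd_above (f0 ` S)" for S using f0(3) by (auto intro: bdd_aboveI[of _ 1])
  have ne: "x +o K \<noteq> {}" for x using coset_self by blast
  have f_le: "f x \<le> c" if "\<And>k. k \<in> K \<Longrightarrow> f0 (x + k) \<le> c" for x c
    unfolding f_def using ne that by (intro cSUP_least) (auto simp: elt_set_plus_def)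
  have f_ge: "f0 (x + k) \<le> f x" if "k \<in> K" for x k
    unfolding f_def using that ba by (intro cSUP_upper) auto
  have f_ge0: "f0 x \<le> f x" for x using f_ge[OF K_0, of x] by simp
  have "\<exists>N. open N \<and> x \<in> N \<and> (\<forall>y\<in>N. \<bar>f y - f x\<bar> \<le> e)" if "e > 0" for x e
  proof -
    define W where "W = (\<lambda>p. f0 (fst p + snd p) - f0 (x + snd p)) -` {-e<..<e}"
    have c: "continuous_on UNIV (\<lambda>p::'g \<times> 'g. f0 (fst p + snd p) - f0 (x + snd p))"
      by (intro continuous_intros continuous_on_compose2[OF f0(1)]) auto
    have "open W" unfolding W_def using c by (intro open_vimage) auto
    moreover have "{x} \<times> K \<subseteq> W" using that by (auto simp: W_def)
    ultimately obtain N where N: "x \<in> N" "open N" "N \<times> K \<subseteq> W"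
      using Elementary_Topology.tube_lemma[OF K(2), of W x] by blast
    have "\<bar>f y - f x\<bar> \<le> e" if "y \<in> N" for y
    proof -
      have *: "f0 (y + k) \<le> f0 (x + k) + e" "f0 (x + k) \<le> f0 (y + k) + e" if "k \<in> K" for k
      proof -
        have "(y, k) \<in> W" using N(3) that \<open>y \<in> N\<close> by blast
        then show "f0 (y + k) \<le> f0 (x + k) + e" "f0 (x + k) \<le> f0 (y + k) + e" by (auto simp: W_def)
      qed
      have "f y \<le> f x + e"
      proof (rule f_le)
        fix k assume k: "k \<in> K"
        show "f0 (y + k) \<le> f x + e" using *(1)[OF k] f_ge[OF k, of x] by linarith
      qed
      moreover have "f x \<le> f y + e"
      proof (rule f_le)
        fix k assume k: "k \<in> K"
        show "f0 (x + k) \<le> f y + e" using *(2)[OF k] f_ge[OF k, of y] by linarith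
      qed
      ultimately show ?thesis by linarith
    qed
    then show ?thesis using N by blast
  qed
  note nbhd = this
  have cont: "continuous_on UNIV f"
  proof (subst continuous_on_def, intro ballI tendstoI)
    fix x and e :: real assume "e > 0"
    then have "e / 2 > 0" by simp
    from nbhd[OF this, of x] obtain N where N: "open N" "x \<in> N" "\<forall>y\<in>N. \<bar>f y - f x\<bar> \<le> e / 2" by metis
    have "\<forall>y\<in>N. dist (f y) (f x) < e"
    proof
      fix y assume "y \<in> N"
      then have "\<bar>f y - f x\<bar> \<le> e / 2" using N(3) by blast
      then show "dist (f y) (f x) < e" using \<open>e > 0\<close> by (simp add: dist_real_def)
    qed
    then show "\<forall>\<^sub>F y in at x within UNIV. dist (f y) (f x) < e"
      unfolding eventually_at_topological using N(1,2) by blast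
  qed
  have f_nonneg: "0 \<le> f x" for x using f_ge0[of x] f0(2)[of x] by linarith
  have ex: "\<exists>k\<in>K. f0 (x + k) \<noteq> 0" if "f x \<noteq> 0" for x
  proof (rule ccontr)
    assume "\<not> ?thesis"
    then have "f x \<le> 0" by (intro f_le) auto
    with f_nonneg[of x] that show False by simp
  qed
  have "{x. f x \<noteq> 0} \<subseteq> L + K"
  proof
    fix x assume "x \<in> {x. f x \<noteq> 0}"
    then obtain k where k: "k \<in> K" "f0 (x + k) \<noteq> 0" using ex by auto
    then have "(x + k) + - k \<in> L + K" using L(2) K_minus by (intro set_plus_intro) auto
    then show "x \<in> L + K" by (simp add: add.assoc)
  qed
  moreover have LK: "compact (L + K)" using L(1) K(2) by (rule compact_set_plus)
  ultimately have "compact (closure {x. f x \<noteq> 0})"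
    using closure_minimal[OF _ compact_imp_closed[OF LK]] compact_Int_closed[OF LK closed_closure] by (metis inf.absorb2)
  moreover have "f x \<le> 1" for x using f0(3) by (intro f_le)
  moreover have "f (x + k) = f x" if "k \<in> K" for x k using that by (simp add: f_def coset_absorb)
  ultimately show ?thesis using cont f_ge0 f_nonneg ex by (intro that[of f])
qed

text \<open>Local compactness encloses \<open>D\<close> in an open \<open>S\<close> inside a compact
  \<open>L\<close>; a Urysohn function vanishing off \<open>S \<inter> W\<close> is then confined to
  \<open>W\<close> and to \<open>L\<close> at once.\<close>

lemma Urysohn_compact_support:
  fixes D W :: "'g::t2_space set"
  assumes lc: "locally_compact_space (euclidean :: 'g topology)" and D: "compact D" and W: "open W" "D \<subseteq> W"
  obtains f :: "'g \<Rightarrow> real" and L where "continuous_on UNIV f" "\<And>x. 0 \<le> f x" "\<And>x. f x \<le> 1"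
    "\<And>x. x \<in> D \<Longrightarrow> f x = 1" "\<And>x. f x \<noteq> 0 \<Longrightarrow> x \<in> W" "compact L" "\<And>x. f x \<noteq> 0 \<Longrightarrow> x \<in> L"
proof -
  have haus: "Hausdorff_space (euclidean :: 'g topology)"
    unfolding Hausdorff_space_def disjnt_def using hausdorff by (metis open_openin)
  have cr: "completely_regular_space (euclidean :: 'g topology)"
    using lc haus by (intro locally_compact_regular_imp_completely_regular_space) auto
  obtain S L where SL: "open S" "compact L" "D \<subseteq> S" "S \<subseteq> L"
    using locally_compact_space_compact_closed_compact[of "euclidean :: 'g topology"] haus lc D by auto
  have "closedin euclidean (- (S \<inter> W))" using SL(1) W(1) by (metis closed_closedin closed_Compl open_Int)
  moreover have "disjnt D (- (S \<inter> W))" using SL(3) W(2) by (auto simp: disjnt_def)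
  ultimately obtain f where f: "continuous_map euclidean (top_of_set {0..1::real}) f" "f ` (- (S \<inter> W)) \<subseteq> {0}" "f ` D \<subseteq> {1}"
    using Urysohn_completely_regular_closed_compact[OF zero_le_one cr, of "- (S \<inter> W)" D] D
      Urysohn_completely_regular_compact_closed[OF zero_le_one cr, of D "- (S \<inter> W)"] by (metis compactin_euclidean_iff)
  have "continuous_on UNIV f" "\<And>x. f x \<in> {0..1}"
    using f(1) by (auto simp: continuous_map_in_subtopology)
  then show ?thesis using f(2,3) SL by (intro that[of f L]) (auto, blast+)
qed


section \<open>The quotient measure and its pull-back to the group\<close>

locale haar_quotient = subgroup_cosets K
  for K :: "'g::{topological_group_add,t2_space} set" +
  fixes lamG lamK :: "'g measure" and mu :: "'g set measure"
  assumes lc: "locally_compact_space (euclidean :: 'g topology)"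
    and haarG: "left_haar_measure UNIV lamG"
    and compact_K: "compact K"
    and haarK: "left_haar_measure K lamK" "emeasure lamK K = 1"
    and quotient: "normalised_quotient_measure K lamG lamK mu"
begin

lemma radon_mu: "radon_measure (coset_topology K) mu"
  and translate_mu: "A \<in> sets mu \<Longrightarrow> emeasure mu ((\<lambda>p. g +o p) ` A) = emeasure mu A"
  using quotient by (auto simp: normalised_quotient_measure_def)

lemma space_mu: "space mu = cosets K"
  using radon_mu by (simp add: radon_measure_def topspace_coset_topology)

lemma sets_mu: "sets mu = sets (sigma (cosets K) {S. openin (coset_topology K) S})"
  using radon_mu by (simp add: radon_measure_def topspace_coset_topology borel_of_topology_def)

lemma open_Pow_cosets: "{S. openin (coset_topology K) S} \<subseteq> Pow (cosets K)"
  by (auto simp: openin_coset_topology)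

lemma openin_sets_mu: "openin (coset_topology K) S \<Longrightarrow> S \<in> sets mu"
  unfolding sets_mu using open_Pow_cosets by (simp add: sets_measure_of sigma_sets.Basic)

lemma coset_in: "x +o K \<in> cosets K" by (simp add: cosets_def)

text \<open>
  The pull-back of \<open>mu\<close> to the group, defined on right \<open>K\<close>-invariant sets only.
\<close>

definition nu :: "'g measure" where
  "nu = distr mu (vimage_algebra UNIV (\<lambda>x. x +o K) mu) rep"

lemma sets_nu_eq: "sets nu = sets (vimage_algebra UNIV (\<lambda>x. x +o K) mu)"
  by (simp add: nu_def)

lemma space_nu: "space nu = UNIV" by (simp add: nu_def)

lemma sets_nu: "sets nu = {(\<lambda>x. x +o K) -` S | S. S \<in> sets mu}"
  unfolding sets_nu_eq by (subst sets_vimage_algebra2) (auto simp: space_mu coset_in)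

lemma coset_measurable: "(\<lambda>x. x +o K) \<in> nu \<rightarrow>\<^sub>M mu"
  using measurable_vimage_algebra1[of "\<lambda>x. x +o K" UNIV mu]
  by (simp add: measurable_cong_sets[OF sets_nu_eq refl] space_mu coset_in)

lemma measurable_into_nu:
  assumes "(\<lambda>y. f y +o K) \<in> N \<rightarrow>\<^sub>M mu" shows "f \<in> N \<rightarrow>\<^sub>M nu"
  using measurable_vimage_algebra2[of f N UNIV "\<lambda>x. x +o K" mu] assms
  by (simp add: measurable_cong_sets[OF refl sets_nu_eq])

text \<open>However wild the choice of representatives, the sigma-algebra of \<open>nu\<close> sees
  only their cosets, and the coset of a representative of \<open>p\<close> is
  \<open>p\<close>.\<close>

lemma rep_measurable: "rep \<in> mu \<rightarrow>\<^sub>M nu"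
proof (rule measurable_into_nu)
  have "(\<lambda>p. rep p +o K) \<in> mu \<rightarrow>\<^sub>M mu \<longleftrightarrow> (\<lambda>p. p) \<in> mu \<rightarrow>\<^sub>M mu"
    by (rule measurable_cong) (simp add: space_mu rep_coset')
  then show "(\<lambda>p. rep p +o K) \<in> mu \<rightarrow>\<^sub>M mu" by simp
qed

lemma nu_distr: "nu = distr mu nu rep"
  by (subst nu_def, rule distr_cong) (simp_all add: sets_nu_eq)

text \<open>Pulling a saturated set back along \<open>rep\<close> returns the original set of
  cosets, so the choice of representatives leaves no trace in \<open>nu\<close>.\<close>

lemma emeasure_nu: assumes "S \<in> sets mu" shows "emeasure nu ((\<lambda>x. x +o K) -` S) = emeasure mu S"
proof -
  have "(\<lambda>x. x +o K) -` S \<in> sets nu" using assms by (auto simp: sets_nu)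
  then have "emeasure nu ((\<lambda>x. x +o K) -` S) = emeasure mu (rep -` ((\<lambda>x. x +o K) -` S) \<inter> space mu)"
    by (subst nu_distr) (simp add: emeasure_distr rep_measurable)
  also have "rep -` ((\<lambda>x. x +o K) -` S) \<inter> space mu = S"
    using sets.sets_into_space[OF assms] by (auto simp: space_mu rep_coset')
  finally show ?thesis .
qed

lemma translate_mu_measurable: "(\<lambda>p. s +o p) \<in> mu \<rightarrow>\<^sub>M mu"
proof -
  have "(\<lambda>p. s +o p) \<in> mu \<rightarrow>\<^sub>M sigma (cosets K) {S. openin (coset_topology K) S}"
  proof (rule measurable_measure_of[OF open_Pow_cosets])
    show "(\<lambda>p. s +o p) \<in> space mu \<rightarrow> cosets K"
      by (auto simp: space_mu cosets_def translate_coset)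
    fix S assume "S \<in> {S. openin (coset_topology K) S}"
    then have "open ((\<lambda>x. x +o K) -` S)" by (simp add: openin_coset_topology)
    then have "open ((\<lambda>x. s + x) -` ((\<lambda>x. x +o K) -` S))" by (rule open_plus_vimage)
    moreover have "(\<lambda>x. s + x) -` ((\<lambda>x. x +o K) -` S) = (\<lambda>x. x +o K) -` ((\<lambda>p. s +o p) -` S \<inter> space mu)"
      by (auto simp: space_mu coset_in translate_coset)
    ultimately have "openin (coset_topology K) ((\<lambda>p. s +o p) -` S \<inter> space mu)"
      by (simp add: openin_coset_topology space_mu)
    then show "(\<lambda>p. s +o p) -` S \<inter> space mu \<in> sets mu" by (rule openin_sets_mu)
  qed
  then show ?thesis by (simp add: measurable_cong_sets[OF refl sets_mu])
qed

lemma translate_nu_measurable: "(\<lambda>x. s + x) \<in> nu \<rightarrow>\<^sub>M nu"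
  using measurable_comp[OF coset_measurable translate_mu_measurable[of s]]
  by (intro measurable_into_nu) (simp add: o_def translate_coset)

lemma translate_nu: "distr nu nu (\<lambda>x. s + x) = nu"
proof (rule measure_eqI)
  fix A assume "A \<in> sets (distr nu nu (\<lambda>x. s + x))"
  then obtain S where S: "S \<in> sets mu" "A = (\<lambda>x. x +o K) -` S" by (auto simp: sets_nu)
  have S': "S \<subseteq> cosets K" using sets.sets_into_space[OF S(1)] by (simp add: space_mu)
  have inj: "- s +o (s +o p) = p" "s +o (- s +o p) = p" for p
    by (simp_all only: set_plus_rearrange2 left_minus right_minus) (auto simp: elt_set_plus_def)
  have cos: "- s +o p \<in> cosets K" if "p \<in> cosets K" for p using that by (auto simp: cosets_def translate_coset)
  have eq: "(\<lambda>p. s +o p) -` S \<inter> space mu = (\<lambda>p. - s +o p) ` S"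
  proof (intro equalityI subsetI)
    fix p assume "p \<in> (\<lambda>p. s +o p) -` S \<inter> space mu"
    then show "p \<in> (\<lambda>p. - s +o p) ` S" by (intro image_eqI[of _ _ "s +o p"]) (auto simp: inj)
  next
    fix p assume "p \<in> (\<lambda>p. - s +o p) ` S"
    then show "p \<in> (\<lambda>p. s +o p) -` S \<inter> space mu" using S' cos by (auto simp: inj space_mu)
  qed
  have "A \<in> sets nu" using S by (auto simp: sets_nu)
  then have "emeasure (distr nu nu (\<lambda>x. s + x)) A = emeasure nu ((\<lambda>x. s + x) -` A)"
    by (simp add: emeasure_distr translate_nu_measurable space_nu)
  also have "(\<lambda>x. s + x) -` A = (\<lambda>x. x +o K) -` ((\<lambda>p. - s +o p) ` S)"
    unfolding S(2) eq[symmetric] by (auto simp: translate_coset space_mu coset_in)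
  also have "emeasure nu \<dots> = emeasure mu ((\<lambda>p. - s +o p) ` S)"
    using measurable_sets[OF translate_mu_measurable[of s] S(1)] unfolding eq by (rule emeasure_nu)
  also have "\<dots> = emeasure nu A" unfolding translate_mu[OF S(1)] S(2) emeasure_nu[OF S(1)] ..
  finally show "emeasure (distr nu nu (\<lambda>x. s + x)) A = emeasure nu A" .
qed simp

lemma
  assumes "A \<in> sets nu"
  shows sets_image_translate: "(\<lambda>x. s + x) ` A \<in> sets nu"
    and measure_image_translate: "measure nu ((\<lambda>x. s + x) ` A) = measure nu A"
    and emeasure_image_translate: "emeasure nu ((\<lambda>x. s + x) ` A) = emeasure nu A"
proof -
  show "(\<lambda>x. s + x) ` A \<in> sets nu"
    using measurable_sets[OF translate_nu_measurable assms, of "- s"]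
    by (simp add: image_plus_eq_vimage space_nu)
  have "emeasure nu ((\<lambda>x. s + x) ` A) = emeasure (distr nu nu (\<lambda>x. - s + x)) A"
    using assms by (simp add: emeasure_distr translate_nu_measurable space_nu image_plus_eq_vimage)
  then show "emeasure nu ((\<lambda>x. s + x) ` A) = emeasure nu A" by (simp add: translate_nu)
  then show "measure nu ((\<lambda>x. s + x) ` A) = measure nu A" by (simp add: measure_def)
qed

lemma open_sets_nu:
  assumes "open A" "right_invariant K A" shows "A \<in> sets nu"
proof -
  have "A = (\<lambda>x. x +o K) -` ((\<lambda>x. x +o K) ` A)" using vimage_image_coset[OF assms(2)] by simp
  then show ?thesis unfolding sets_nu using openin_sets_mu[OF open_image_coset[OF assms(1)]] by blast
qed

lemma emeasure_nu_open:
  assumes "open A" "right_invariant K A" shows "emeasure nu A = emeasure mu ((\<lambda>x. x +o K) ` A)"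
  using emeasure_nu[OF openin_sets_mu[OF open_image_coset[OF assms(1)]]] vimage_image_coset[OF assms(2)] by simp

lemma compact_sets_nu:
  assumes "compact L" shows "L + K \<in> sets nu" "emeasure nu (L + K) < \<infinity>"
proof -
  have "closed (L + K)" using compact_imp_closed[OF compact_set_plus[OF assms compact_K]] .
  then have "- (L + K) \<in> sets nu"
    by (intro open_sets_nu right_invariant_Compl right_invariant_plus_K) auto
  then have "space nu - - (L + K) \<in> sets nu" by (rule sets.compl_sets)
  then show L: "L + K \<in> sets nu" by (simp add: space_nu Compl_eq_Diff_UNIV[symmetric])
  then obtain S where S: "S \<in> sets mu" "L + K = (\<lambda>x. x +o K) -` S" by (auto simp: sets_nu)
  have "S = (\<lambda>x. x +o K) ` (L + K)"
    using sets.sets_into_space[OF S(1)] unfolding S(2) by (auto simp: space_mu cosets_def)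
  then have "S = (\<lambda>x. x +o K) ` L" using image_plus_K by simp
  then have "compactin (coset_topology K) S" using compactin_image_coset[OF assms] by simp
  then have "emeasure mu S < \<infinity>" using radon_mu by (auto simp: radon_measure_def)
  then show "emeasure nu (L + K) < \<infinity>" unfolding S(2) emeasure_nu[OF S(1)] .
qed

lemma radon_lamG: "radon_measure euclidean lamG" "emeasure lamG UNIV \<noteq> 0"
  using haarG by (auto simp: left_haar_measure_def)

lemma sets_lamG: "sets lamG = sets borel" and space_lamG: "space lamG = UNIV"
  using radon_lamG(1) by (auto simp: radon_measure_def borel_of_topology_euclidean)

lemma compact_lamG: "compact C \<Longrightarrow> emeasure lamG C < \<infinity>"
  using radon_lamG(1) by (auto simp: radon_measure_def)

lemma measurable_nu:
  fixes f :: "'g \<Rightarrow> real"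
  assumes "continuous_on UNIV f" "\<And>x k. k \<in> K \<Longrightarrow> f (x + k) = f x"
  shows "f \<in> borel_measurable nu"
proof (rule borel_measurableI)
  fix S :: "real set" assume "open S"
  then have "open (f -` S)" using assms(1) by (simp add: open_vimage)
  moreover have "right_invariant K (f -` S)" using assms(2) by (simp add: right_invariant_def)
  ultimately show "f -` S \<inter> space nu \<in> sets nu" by (simp add: space_nu open_sets_nu)
qed

section \<open>Comparison of the pull-back with Haar measure\<close>

text \<open>For a right K-invariant \<open>f\<close> the inner integral over \<open>K\<close> is
  just the value at the representative, because \<open>lamK\<close> has mass 1. All comparisons of
  \<open>lamG\<close> with \<open>nu\<close> rest on such functions.\<close>

lemma Weil_formula:
  fixes f :: "'g \<Rightarrow> real"
  assumes f: "continuous_on UNIV f" "\<And>x. 0 \<le> f x" "\<And>x. f x \<le> 1" "\<And>x k. k \<in> K \<Longrightarrow> f (x + k) = f x"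
    and supp: "compact (closure {x. f x \<noteq> 0})"
  shows "integrable lamG f" "integrable nu f" "(\<integral>x. f x \<partial>lamG) = (\<integral>x. f x \<partial>nu)"
proof -
  define C where "C = closure {x. f x \<noteq> 0}"
  have C: "compact C" "\<And>x. f x \<noteq> 0 \<Longrightarrow> x \<in> C" using supp closure_subset[of "{x. f x \<noteq> 0}"] by (auto simp: C_def)
  have f_le: "\<bar>f x\<bar> \<le> indicator S x" if "C \<subseteq> S" for x S
    using f(2,3)[of x] C(2)[of x] that by (cases "f x = 0") (auto simp: indicator_def)
  show "integrable lamG f"
  proof (rule Bochner_Integration.integrable_bound[of lamG "indicator C :: 'g \<Rightarrow> real"])
    have "C \<in> sets lamG" using compact_imp_closed[OF C(1)] by (simp add: sets_lamG borel_closed)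
    then show "integrable lamG (indicator C :: 'g \<Rightarrow> real)"
      using compact_lamG[OF C(1)] by (simp add: integrable_indicator_iff)
    show "f \<in> borel_measurable lamG"
      using borel_measurable_continuous_onI[OF f(1)] by (simp add: measurable_cong_sets[OF sets_lamG refl])
  qed (use f_le[of C] in auto)
  show "integrable nu f"
  proof (rule Bochner_Integration.integrable_bound[of nu "indicator (C + K) :: 'g \<Rightarrow> real"])
    show "integrable nu (indicator (C + K) :: 'g \<Rightarrow> real)"
      using compact_sets_nu[OF C(1)] by (simp add: integrable_indicator_iff)
    show "f \<in> borel_measurable nu" using f(1,4) by (rule measurable_nu)
  qed (use f_le[OF subset_plus_K] in auto)
  have sp: "space lamK = K" using haarK(1) by (auto simp: left_haar_measure_def radon_measure_def)
  have "(\<integral>k. f (rep p + k) \<partial>lamK) = f (rep p)" for p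
  proof -
    have "(\<integral>k. f (rep p + k) \<partial>lamK) = (\<integral>k. f (rep p) \<partial>lamK)"
      by (rule Bochner_Integration.integral_cong) (auto simp: sp f(4))
    also have "\<dots> = f (rep p)" using haarK(2) by (simp add: sp measure_def)
    finally show ?thesis .
  qed
  moreover have "(\<integral>x. f x \<partial>lamG) = (\<integral>p. (\<integral>k. f (rep p + k) \<partial>lamK) \<partial>mu)"
    using quotient f(1) supp unfolding normalised_quotient_measure_def rep_def by blast
  moreover have "(\<integral>x. f x \<partial>nu) = (\<integral>p. f (rep p) \<partial>mu)"
    by (subst nu_distr) (rule integral_distr[OF rep_measurable measurable_nu[OF f(1,4)]])
  ultimately show "(\<integral>x. f x \<partial>lamG) = (\<integral>x. f x \<partial>nu)" by simp
qed

text \<open>The invariant majorant of an ordinary Urysohn function; it is still confined to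
  \<open>W\<close> because \<open>W\<close> is saturated.\<close>

lemma invariant_Urysohn:
  assumes D: "compact D" "D \<subseteq> W" and W: "open W" "right_invariant K W"
  obtains f :: "'g \<Rightarrow> real" where "\<And>x. 0 \<le> f x" "\<And>x. f x \<le> 1" "\<And>x k. k \<in> K \<Longrightarrow> f (x + k) = f x"
    "\<And>x. x \<in> D + K \<Longrightarrow> f x = 1" "\<And>x. f x \<noteq> 0 \<Longrightarrow> x \<in> W"
    "integrable lamG f" "integrable nu f" "(\<integral>x. f x \<partial>lamG) = (\<integral>x. f x \<partial>nu)"
proof -
  obtain f0 :: "'g \<Rightarrow> real" and L where f0: "continuous_on UNIV f0" "\<And>x. 0 \<le> f0 x" "\<And>x. f0 x \<le> 1"
    "\<And>x. x \<in> D \<Longrightarrow> f0 x = 1" "\<And>x. f0 x \<noteq> 0 \<Longrightarrow> x \<in> W" "compact L" "\<And>x. f0 x \<noteq> 0 \<Longrightarrow> x \<in> L"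
    by (rule Urysohn_compact_support[OF lc D(1) W(1) D(2)]) blast
  obtain f where f: "continuous_on UNIV f" "\<And>x. f0 x \<le> f x" "\<And>x. 0 \<le> f x" "\<And>x. f x \<le> 1"
    "\<And>x k. k \<in> K \<Longrightarrow> f (x + k) = f x" "compact (closure {x. f x \<noteq> 0})"
    "\<And>x. f x \<noteq> 0 \<Longrightarrow> \<exists>k\<in>K. f0 (x + k) \<noteq> 0"
    by (rule invariant_majorant[OF subgroup compact_K f0(1-3,6)]) (rule f0(7), assumption, rule that)
  have "f x = 1" if x: "x \<in> D + K" for x
  proof -
    obtain d k where dk: "d \<in> D" "k \<in> K" "x = d + k" using x by (auto elim: set_plus_elim)
    then have "f x = f d" using f(5) by simp
    then show ?thesis using f(2,4)[of d] f0(4)[OF dk(1)] by simp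
  qed
  moreover have "x \<in> W" if x: "f x \<noteq> 0" for x
  proof -
    obtain k where k: "k \<in> K" "x + k \<in> W" using f(7)[OF x] f0(5) by blast
    then have "x + k + - k \<in> W" using W(2) K_minus unfolding right_invariant_def by blast
    then show ?thesis by (simp add: add.assoc)
  qed
  ultimately show ?thesis using f(3,4,5) Weil_formula[OF f(1,3,4,5,6)] by (intro that[of f])
qed

text \<open>The coset map is open, so the images of the sets \<open>N x\<close> form an open cover
  of \<open>C\<close>. This lifts compactness to the group without a compact preimage of
  \<open>C\<close>.\<close>

lemma compactin_cover:
  assumes C: "compactin (coset_topology K) C" "C \<subseteq> (\<lambda>x. x +o K) ` W"
    and N: "\<And>x. x \<in> W \<Longrightarrow> open (N x) \<and> x \<in> N x"
  obtains F where "finite F" "F \<subseteq> W" "C \<subseteq> (\<lambda>x. x +o K) ` (\<Union>x\<in>F. N x)"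
proof -
  define U where "U = (\<lambda>x. (\<lambda>y. y +o K) ` N x) ` W"
  have "\<forall>S\<in>U. openin (coset_topology K) S" using N open_image_coset by (auto simp: U_def)
  moreover have "C \<subseteq> \<Union>U"
  proof
    fix p assume "p \<in> C"
    then obtain x where "x \<in> W" "p = x +o K" using C(2) by blast
    then show "p \<in> \<Union>U" using N unfolding U_def by blast
  qed
  ultimately obtain U' where U': "finite U'" "U' \<subseteq> U" "C \<subseteq> \<Union>U'"
    using C(1) unfolding compactin_def by meson
  then obtain F where F: "F \<subseteq> W" "finite F" "U' = (\<lambda>x. (\<lambda>y. y +o K) ` N x) ` F"
    unfolding U_def using finite_subset_image by metis
  have "\<Union>U' = (\<lambda>x. x +o K) ` (\<Union>x\<in>F. N x)" by (simp only: F(3) image_UN)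
  then show ?thesis using F U'(3) by (intro that[of F]) simp_all
qed

lemma emeasure_mu_SUP:
  assumes "openin (coset_topology K) S"
  shows "emeasure mu S = (SUP C\<in>{C. compactin (coset_topology K) C \<and> C \<subseteq> S}. emeasure mu C)"
  using radon_mu assms by (simp add: radon_measure_def)

text \<open>By inner regularity of \<open>mu\<close> it is enough to bound compact sets
  \<open>C\<close> of cosets. A finite union of compact neighbourhoods gives a compact
  \<open>D \<subseteq> W\<close> whose image covers \<open>C\<close>, and an invariant test function
  between the indicators of \<open>D + K\<close> and \<open>U\<close> has the same integral for both
  measures.\<close>

lemma emeasure_nu_le_lamG:
  assumes W: "open W" "right_invariant K W" and U: "W \<subseteq> U" "U \<in> sets lamG" "emeasure lamG U < \<infinity>"
  shows "emeasure nu W \<le> emeasure lamG U"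
proof -
  have "emeasure mu C \<le> emeasure lamG U"
    if C: "compactin (coset_topology K) C" "C \<subseteq> (\<lambda>x. x +o K) ` W" for C
  \<comment> \<open>A set outside the sigma-algebra has \<open>emeasure\<close> 0 by convention,
    which spares a proof that compact sets of cosets are measurable.\<close>
  proof (cases "C \<in> sets mu")
    case True
    have haus: "Hausdorff_space (euclidean :: 'g topology)"
      unfolding Hausdorff_space_def disjnt_def using hausdorff by (metis open_openin)
    have nb: "neighbourhood_base_of (compactin euclidean) (euclidean :: 'g topology)"
      using lc haus locally_compact_space_neighbourhood_base by blast
    have "\<exists>N L. open N \<and> compact L \<and> x \<in> N \<and> N \<subseteq> L \<and> L \<subseteq> W" if "x \<in> W" for x
      using nb that W(1) unfolding neighbourhood_base_of by (metis compactin_euclidean_iff open_openin)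
    then obtain N L where NL: "\<And>x. x \<in> W \<Longrightarrow> open (N x) \<and> x \<in> N x"
      "\<And>x. x \<in> W \<Longrightarrow> compact (L x) \<and> N x \<subseteq> L x \<and> L x \<subseteq> W" by metis
    obtain F where F: "finite F" "F \<subseteq> W" "C \<subseteq> (\<lambda>x. x +o K) ` (\<Union>x\<in>F. N x)"
      by (rule compactin_cover[OF C NL(1)])
    define D where "D = (\<Union>x\<in>F. L x)"
    have D: "compact D" "D \<subseteq> W" using F(1,2) NL(2) by (auto simp: D_def)
    have CD: "C \<subseteq> (\<lambda>x. x +o K) ` D" using F NL(2) unfolding D_def by blast
    obtain f :: "'g \<Rightarrow> real" where f: "\<And>x. 0 \<le> f x" "\<And>x. f x \<le> 1" "\<And>x k. k \<in> K \<Longrightarrow> f (x + k) = f x"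
      "\<And>x. x \<in> D + K \<Longrightarrow> f x = 1" "\<And>x. f x \<noteq> 0 \<Longrightarrow> x \<in> W"
      "integrable lamG f" "integrable nu f" "(\<integral>x. f x \<partial>lamG) = (\<integral>x. f x \<partial>nu)"
      by (rule invariant_Urysohn[OF D W]) blast
    have "(\<lambda>x. x +o K) -` C \<subseteq> (\<lambda>x. x +o K) -` (\<lambda>x. x +o K) ` (D + K)"
      unfolding image_plus_K using CD by (rule vimage_mono)
    then have CDK: "(\<lambda>x. x +o K) -` C \<subseteq> D + K"
      unfolding vimage_image_coset[OF right_invariant_plus_K] .
    have "emeasure mu C = emeasure nu ((\<lambda>x. x +o K) -` C)" using True by (simp add: emeasure_nu)
    also have "\<dots> \<le> emeasure nu (D + K)"
      using CDK compact_sets_nu(1)[OF D(1)] by (rule emeasure_mono)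
    also have "\<dots> = ennreal (measure nu (D + K))"
      using compact_sets_nu(2)[OF D(1)] by (intro emeasure_eq_ennreal_measure) auto
    also have "measure nu (D + K) = (\<integral>x. indicator (D + K) x \<partial>nu)" by (simp add: space_nu)
    also have "\<dots> \<le> (\<integral>x. f x \<partial>nu)"
    proof (rule integral_mono)
      show "integrable nu (indicator (D + K) :: 'g \<Rightarrow> real)"
        using compact_sets_nu[OF D(1)] by (simp add: integrable_indicator_iff)
    qed (use f(1,4,7) in \<open>auto simp: indicator_def\<close>)
    also have "\<dots> = (\<integral>x. f x \<partial>lamG)" using f(8) by simp
    also have "\<dots> \<le> (\<integral>x. indicator U x \<partial>lamG)"
    proof (rule integral_mono)
      show "integrable lamG (indicator U :: 'g \<Rightarrow> real)"
        using U by (simp add: integrable_indicator_iff)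
      show "f x \<le> indicator U x" for x
        using f(2)[of x] f(5)[of x] U(1) by (cases "f x = 0") (auto simp: indicator_def)
    qed (rule f(6))
    also have "\<dots> = measure lamG U" by (simp add: space_lamG)
    also have "ennreal (measure lamG U) = emeasure lamG U"
      using U(3) by (intro emeasure_eq_ennreal_measure[symmetric]) auto
    finally show ?thesis by (simp add: ennreal_leI)
  qed (simp add: emeasure_notin_sets)
  then show ?thesis
    unfolding emeasure_nu_open[OF W] emeasure_mu_SUP[OF open_image_coset[OF W(1)]] by (auto intro: SUP_least)
qed

text \<open>Translates of a null open set cover every compact set of cosets finitely often, so
  \<open>mu\<close>, and with it \<open>nu\<close>, would vanish. Test functions that are 1 on a
  compact set then carry this over to \<open>lamG\<close>, contradicting that Haar measure is
  nonzero.\<close>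

lemma emeasure_nu_pos:
  assumes A: "open A" "right_invariant K A" "A \<noteq> {}"
  shows "emeasure nu A \<noteq> 0"
proof
  assume 0: "emeasure nu A = 0"
  obtain a where a: "a \<in> A" using A(3) by blast
  have null: "(\<lambda>y. y +o K) ` ((\<lambda>x. s + x) ` A) \<in> null_sets mu" for s
  proof -
    have o: "open ((\<lambda>x. s + x) ` A)" using A(1) by (rule open_plus_vimage)
    have "right_invariant K ((\<lambda>x. s + x) ` A)"
      using A(2) unfolding right_invariant_def by (auto simp: add.assoc)
    moreover have "emeasure nu ((\<lambda>x. s + x) ` A) = emeasure nu A"
      using open_sets_nu[OF A(1,2)] by (rule emeasure_image_translate)
    ultimately show ?thesis
      using 0 emeasure_nu_open[OF o] openin_sets_mu[OF open_image_coset[OF o]] by (simp add: null_sets_def)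
  qed
  have "emeasure mu C = 0" if C: "compactin (coset_topology K) C" for C
  proof -
    have "C \<subseteq> cosets K" using compactin_subset_topspace[OF C] by (simp add: topspace_coset_topology)
    then have CU: "C \<subseteq> (\<lambda>x. x +o K) ` UNIV" by (auto simp: cosets_def)
    have N: "open ((\<lambda>y. (x + - a) + y) ` A) \<and> x \<in> (\<lambda>y. (x + - a) + y) ` A" if "x \<in> UNIV" for x
      using open_plus_vimage(3)[OF A(1)] a by (auto intro!: image_eqI[of _ _ a] simp: add.assoc)
    obtain F where F: "finite F" "C \<subseteq> (\<lambda>x. x +o K) ` (\<Union>x\<in>F. (\<lambda>y. (x + - a) + y) ` A)"
      by (rule compactin_cover[OF C CU N])
    have "(\<Union>x\<in>F. (\<lambda>y. y +o K) ` ((\<lambda>y. (x + - a) + y) ` A)) \<in> null_sets mu"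
      using F(1) null by (intro null_sets_UN') (auto simp: countable_finite)
    moreover have "C \<subseteq> (\<Union>x\<in>F. (\<lambda>y. y +o K) ` ((\<lambda>y. (x + - a) + y) ` A))" using F(2) by (simp add: image_UN)
    ultimately show ?thesis by (metis emeasure_mono null_setsD1 null_setsD2 le_zero_eq)
  qed
  note null_C = this
  have "openin (coset_topology K) (cosets K)"
    using openin_topspace[of "coset_topology K"] by (simp add: topspace_coset_topology)
  from emeasure_mu_SUP[OF this] have "emeasure mu (cosets K) \<le> 0"
    by (simp only:) (rule SUP_least, simp add: null_C)
  then have "emeasure nu UNIV = 0"
    using emeasure_nu_open[of UNIV] by (simp add: right_invariant_def cosets_def)
  then have null_nu: "(\<integral>x. f x \<partial>nu) = 0" for f :: "'g \<Rightarrow> real"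
  proof -
    have "AE x in nu. f x = 0" by (rule AE_I[of _ _ UNIV]) (use \<open>emeasure nu UNIV = 0\<close> sets.top[of nu] in \<open>auto simp: space_nu\<close>)
    then show ?thesis by (rule integral_eq_zero_AE)
  qed
  have "emeasure lamG D = 0" if D: "compact D" for D
  proof -
    obtain f :: "'g \<Rightarrow> real" where f: "\<And>x. 0 \<le> f x" "\<And>x. x \<in> D + K \<Longrightarrow> f x = 1"
      "integrable lamG f" "(\<integral>x. f x \<partial>lamG) = (\<integral>x. f x \<partial>nu)"
      by (rule invariant_Urysohn[OF D subset_UNIV open_UNIV]) (auto simp: right_invariant_def)
    have Ds: "D \<in> sets lamG" using compact_imp_closed[OF D] by (simp add: sets_lamG borel_closed)
    have "measure lamG D = (\<integral>x. indicator D x \<partial>lamG)" by (simp add: space_lamG)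
    also have "\<dots> \<le> (\<integral>x. f x \<partial>lamG)"
    proof (rule integral_mono)
      show "integrable lamG (indicator D :: 'g \<Rightarrow> real)"
        using Ds compact_lamG[OF D] by (simp add: integrable_indicator_iff)
    qed (use f(1,2,3) subset_plus_K[of D] in \<open>auto simp: indicator_def subset_iff\<close>)
    also have "\<dots> = 0" using f(4) null_nu by simp
    finally have "measure lamG D = 0" by (simp add: measure_le_0_iff)
    then show ?thesis using compact_lamG[OF D] emeasure_eq_ennreal_measure[of lamG D] by simp
  qed
  moreover have "emeasure lamG UNIV = (SUP C\<in>{C. compact C}. emeasure lamG C)"
    using radon_lamG(1) unfolding radon_measure_def by (auto simp: compactin_euclidean_iff)
  ultimately have "emeasure lamG UNIV = 0" by (auto simp: SUP_eq_const bot_ennreal intro!: antisym SUP_least)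
  then show False using radon_lamG(2) by simp
qed

text \<open>Inner regularity gives a saturated \<open>C' \<subseteq> W\<close> that misses less than
  \<open>e\<close> of the measure. Compactness gives a neighbourhood of 0 whose elements
  \<open>s\<close> move \<open>C'\<close> into \<open>W\<close>; what leaves \<open>W\<close> then
  comes from \<open>W - C'\<close>.\<close>

lemma translate_continuous:
  assumes W: "open W" "right_invariant K W" "emeasure nu W < \<infinity>" and e: "e > 0"
  obtains N where "open N" "0 \<in> N" "\<And>s. s \<in> N \<Longrightarrow> measure nu ((\<lambda>x. s + x) ` W - W) < e"
proof (cases "measure nu W < e")
  \<comment> \<open>Treated separately because \<open>ennreal\<close> truncates negative numbers to
    0; the other case has \<open>measure nu W - e \<ge> 0\<close>.\<close>
  case True
  have "measure nu ((\<lambda>x. s + x) ` W - W) < e" for s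
  proof -
    have "measure nu ((\<lambda>x. s + x) ` W - W) \<le> measure nu ((\<lambda>x. s + x) ` W)"
      using W open_sets_nu[OF W(1,2)]
      by (intro measure_mono_fmeasurable) (auto simp: fmeasurable_def sets_image_translate emeasure_image_translate)
    then show ?thesis using True open_sets_nu[OF W(1,2)] by (simp add: measure_image_translate)
  qed
  then show ?thesis using that[of UNIV] by simp
next
  case False
  have Ws: "W \<in> sets nu" using W(1,2) by (rule open_sets_nu)
  have Wm: "emeasure nu W = ennreal (measure nu W)" using W(3) by (intro emeasure_eq_ennreal_measure) auto
  have "ennreal (measure nu W - e) < emeasure mu ((\<lambda>x. x +o K) ` W)"
    unfolding emeasure_nu_open[OF W(1,2), symmetric] Wm using False e by (intro ennreal_lessI) auto
  then obtain C where C: "compactin (coset_topology K) C" "C \<subseteq> (\<lambda>x. x +o K) ` W"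
    "ennreal (measure nu W - e) < emeasure mu C"
    unfolding emeasure_mu_SUP[OF open_image_coset[OF W(1)]] less_SUP_iff by blast
  \<comment> \<open>\<open>C\<close> is measurable because its \<open>emeasure\<close> is positive,
    while a set outside the sigma-algebra would get 0.\<close>
  have Cs: "C \<in> sets mu" using C(3) emeasure_notin_sets[of C mu] by (cases "C \<in> sets mu") auto
  define C' where "C' = (\<lambda>x. x +o K) -` C"
  have C's: "C' \<in> sets nu" using Cs by (auto simp: C'_def sets_nu)
  have "C' \<subseteq> (\<lambda>x. x +o K) -` (\<lambda>x. x +o K) ` W" unfolding C'_def using C(2) by (rule vimage_mono)
  then have C'W: "C' \<subseteq> W" unfolding vimage_image_coset[OF W(2)] .
  have "emeasure nu C' \<le> emeasure nu W" using C'W Ws by (rule emeasure_mono)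
  then have C'f: "emeasure nu C' < \<infinity>" using W(3) by simp
  have "ennreal (measure nu W - e) < ennreal (measure nu C')"
    using C(3) C'f emeasure_nu[OF Cs] emeasure_eq_ennreal_measure[of nu C'] by (simp add: C'_def)
  then have C'm: "measure nu W - e < measure nu C'" using False by (simp add: ennreal_less_iff)
  have "\<exists>A B. open A \<and> 0 \<in> A \<and> open B \<and> x \<in> B \<and> (\<forall>a\<in>A. \<forall>b\<in>B. a + b \<in> W)" if "x \<in> W" for x
  proof -
    have "open ((\<lambda>p::'g \<times> 'g. fst p + snd p) -` W)"
      using W(1) by (intro open_vimage continuous_intros)
    moreover have "(0, x) \<in> (\<lambda>p. fst p + snd p) -` W" using that by simp
    ultimately obtain A B where "open A" "open B" "(0, x) \<in> A \<times> B" "A \<times> B \<subseteq> (\<lambda>p. fst p + snd p) -` W"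
      by (rule open_prod_elim)
    then show ?thesis by (intro exI[of _ A] exI[of _ B]) auto
  qed
  then obtain A B where AB: "\<And>x. x \<in> W \<Longrightarrow> open (A x) \<and> 0 \<in> A x \<and> (\<forall>a\<in>A x. \<forall>b\<in>B x. a + b \<in> W)"
    "\<And>x. x \<in> W \<Longrightarrow> open (B x) \<and> x \<in> B x" by metis
  obtain F where F: "finite F" "F \<subseteq> W" "C \<subseteq> (\<lambda>x. x +o K) ` (\<Union>x\<in>F. B x)"
    by (rule compactin_cover[OF C(1,2) AB(2)])
  define N where "N = (\<Inter>x\<in>F. A x)"
  have "open N" unfolding N_def using F(1,2) AB(1) by (intro open_INT) auto
  moreover have "0 \<in> N" unfolding N_def using F(2) AB(1) by auto
  moreover have "measure nu ((\<lambda>x. s + x) ` W - W) < e" if s: "s \<in> N" for s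
  proof -
    \<comment> \<open>The point \<open>y\<close> itself need not lie in the covering sets, only some
      \<open>b\<close> in its coset; right invariance of \<open>W\<close> leads from
      \<open>s + b\<close> back to \<open>s + y\<close>.\<close>
    have "s + y \<in> W" if y: "y \<in> C'" for y
    proof -
      have "y +o K \<in> (\<lambda>x. x +o K) ` (\<Union>x\<in>F. B x)" using y F(3) by (auto simp: C'_def)
      then obtain x b where xb: "x \<in> F" "b \<in> B x" "y +o K = b +o K" by auto
      have "s + b \<in> W" using xb(1,2) s F(2) AB(1) by (auto simp: N_def)
      moreover have "- b + y \<in> K" using xb(3) coset_eq[of b y] by simp
      ultimately have "s + b + (- b + y) \<in> W" using W(2) unfolding right_invariant_def by blast
      then show ?thesis by (simp add: add.assoc)
    qed
    then have "(\<lambda>x. s + x) ` W - W \<subseteq> (\<lambda>x. s + x) ` (W - C')" by blast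
    then have "measure nu ((\<lambda>x. s + x) ` W - W) \<le> measure nu ((\<lambda>x. s + x) ` (W - C'))"
    proof (rule measure_mono_fmeasurable)
      have "emeasure nu (W - C') \<le> emeasure nu W" using Ws by (intro emeasure_mono) auto
      then show "(\<lambda>x. s + x) ` (W - C') \<in> fmeasurable nu"
        using W(3) Ws C's by (auto simp: fmeasurable_def sets_image_translate emeasure_image_translate)
    qed (use Ws sets_image_translate in auto)
    also have "\<dots> = measure nu (W - C')" using Ws C's by (intro measure_image_translate) auto
    also have "\<dots> = measure nu W - measure nu C'"
      using Ws C's C'W W(3) by (intro measure_Diff) auto
    also have "\<dots> < e" using C'm by linarith
    finally show ?thesis .
  qed
  ultimately show ?thesis by (rule that)
qed

end

section \<open>Kernels\<close>

locale delsarte_data = haar_quotient K lamG lamK mu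
  for K :: "'g::{topological_group_add,t2_space} set" and lamG lamK mu +
  fixes U V :: "'g set"
  assumes U: "closed U" "bi_invariant K U" "0 \<in> interior U" "emeasure lamG U < \<infinity>"
    and V: "closed V"
begin

lemma interior_U_invariant:
  assumes "x \<in> interior U" "k \<in> K" shows "k + x \<in> interior U" "x + k \<in> interior U"
proof -
  have KUK: "a + y + b \<in> U" if "a \<in> K" "y \<in> U" "b \<in> K" for a y b
    using U(2) that unfolding bi_invariant_def by (metis set_plus_intro)
  have "(\<lambda>x. k + x) ` interior U \<subseteq> U"
    using KUK[OF assms(2) _ K_0] interior_subset[of U] by auto
  then have "(\<lambda>x. k + x) ` interior U \<subseteq> interior U"
    by (intro interior_maximal open_plus_vimage) auto
  then show "k + x \<in> interior U" using assms(1) by blast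
  have "(\<lambda>x. x + - k) -` interior U \<subseteq> U"
  proof
    fix y assume "y \<in> (\<lambda>x. x + - k) -` interior U"
    then have "0 + (y + - k) + k \<in> U" using interior_subset[of U] assms(2) K_0 by (intro KUK) auto
    then show "y \<in> U" by (simp add: add.assoc)
  qed
  then have "(\<lambda>x. x + - k) -` interior U \<subseteq> interior U"
    using open_plus_vimage(2)[of "interior U" "- k"] by (intro interior_maximal) auto
  moreover have "x + k \<in> (\<lambda>x. x + - k) -` interior U" using assms(1) by (simp add: add.assoc)
  ultimately show "x + k \<in> interior U" by blast
qed

lemma right_invariant_interior_U: "right_invariant K (interior U)"
  using interior_U_invariant(2) by (simp add: right_invariant_def)

lemma finite_interior_U: "emeasure nu (interior U) < \<infinity>"
proof -
  have "emeasure nu (interior U) \<le> emeasure lamG U"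
    using U by (intro emeasure_nu_le_lamG right_invariant_interior_U)
      (auto simp: sets_lamG interior_subset borel_closed)
  then show ?thesis using U(4) by simp
qed

sublocale dp: delsarte_problem nu K U V
proof
  show "\<exists>N. open N \<and> 0 \<in> N \<and> (\<forall>s\<in>N. measure nu ((\<lambda>x. s + x) ` interior U - interior U) < e)" if "e > 0" for e
    using translate_continuous[OF open_interior right_invariant_interior_U finite_interior_U that] by metis
  show "A \<in> sets nu" if "open A" "\<And>x k. x \<in> A \<Longrightarrow> k \<in> K \<Longrightarrow> x + k \<in> A" for A
    using that by (intro open_sets_nu) (auto simp: right_invariant_def)
qed (use space_nu translate_nu_measurable translate_nu interior_U_invariant finite_interior_U U V in auto)

section \<open>An admissible function with positive integral\<close>

text \<open>At \<open>a = b = 0\<close> the expression runs through \<open>K\<close>, which lies in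
  \<open>interior U\<close> by invariance. The tube lemma over the compact \<open>K\<close> makes
  the neighbourhood uniform in \<open>k\<close>.\<close>

lemma small_neighbourhood:
  obtains N where "open N" "0 \<in> N" "\<And>a b k. a \<in> N \<Longrightarrow> b \<in> N \<Longrightarrow> k \<in> K \<Longrightarrow> a + k + - b \<in> interior U"
proof -
  define W where "W = (\<lambda>p::('g \<times> 'g) \<times> 'g. fst (fst p) + snd p + - snd (fst p)) -` interior U"
  have "open W" unfolding W_def by (intro open_vimage continuous_intros) auto
  moreover have "{(0, 0)} \<times> K \<subseteq> W" using interior_U_invariant[OF U(3)] by (auto simp: W_def)
  ultimately obtain X where X: "(0, 0) \<in> X" "open X" "X \<times> K \<subseteq> W"
    using Elementary_Topology.tube_lemma[OF compact_K, of W "(0, 0)"] by blast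
  obtain A B where AB: "open A" "open B" "(0, 0) \<in> A \<times> B" "A \<times> B \<subseteq> X"
    using X(2,1) by (rule open_prod_elim)
  have "a + k + - b \<in> interior U" if "a \<in> A \<inter> B" "b \<in> A \<inter> B" "k \<in> K" for a b k
  proof -
    have "((a, b), k) \<in> W" using that AB(4) X(3) by blast
    then show ?thesis by (simp only: W_def vimage_eq fst_conv snd_conv)
  qed
  then show ?thesis using AB by (intro that[of "A \<inter> B"]) auto
qed

text \<open>The witness is the normalised autocorrelation of \<open>W = K + N + K\<close>, the
  measure of \<open>W\<close> intersected with its translate by \<open>x\<close>. Its Gram sums are
  squared norms of combinations of indicators, and it vanishes unless \<open>x\<close> is a
  difference of elements of \<open>W\<close>, hence in \<open>interior U\<close>. Being nonnegative,
  it meets the condition on \<open>V\<close> trivially.\<close>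

lemma adm_positive_integral:
  obtains f where "f \<in> dp.adm" "integrable nu f" "0 < (\<integral>x. f x \<partial>nu)"
proof -
  obtain N where N: "open N" "0 \<in> N" "\<And>a b k. a \<in> N \<Longrightarrow> b \<in> N \<Longrightarrow> k \<in> K \<Longrightarrow> a + k + - b \<in> interior U"
    by (rule small_neighbourhood) blast
  define W where "W = K + N + K"
  have "K + N = (\<Union>k\<in>K. (\<lambda>x. k + x) ` N)" by (force simp: set_plus_def)
  then have "open (K + N)" using open_plus_vimage(3)[OF N(1)] by auto
  then have W_open: "open W" unfolding W_def by (rule open_plus_K)
  have W_right: "right_invariant K W" unfolding W_def by (rule right_invariant_plus_K)
  have W_left: "k + w \<in> W" if k: "k \<in> K" and w: "w \<in> W" for k w
  proof -
    obtain a n b where "w = a + n + b" "a \<in> K" "n \<in> N" "b \<in> K"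
      using w unfolding W_def by (auto elim!: set_plus_elim)
    then have "(k + a) + n + b \<in> W" unfolding W_def using k by (intro set_plus_intro K_plus)
    then show ?thesis using \<open>w = a + n + b\<close> by (simp add: add.assoc)
  qed
  have W_diff: "v + - w \<in> interior U" if vW: "v \<in> W" and wW: "w \<in> W" for v w
  proof -
    obtain a n b where v: "v = a + n + b" "a \<in> K" "n \<in> N" "b \<in> K"
      using vW unfolding W_def by (auto elim!: set_plus_elim)
    obtain a' n' b' where w: "w = a' + n' + b'" "a' \<in> K" "n' \<in> N" "b' \<in> K"
      using wW unfolding W_def by (auto elim!: set_plus_elim)
    \<comment> \<open>The brackets display the order of use: \<open>b + - b'\<close> lies in
      \<open>K\<close>, the middle is handled by \<open>N(3)\<close>, and the outer \<open>a\<close>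
      and \<open>a'\<close> by invariance of \<open>interior U\<close>.\<close>
    have "a + (n + (b + - b') + - n') + - a' \<in> interior U"
      using v w by (intro interior_U_invariant N(3) K_plus K_minus)
    then show ?thesis by (simp only: v(1) w(1) minus_add add.assoc)
  qed
  have "0 + 0 + 0 \<in> W" unfolding W_def using K_0 N(2) by (intro set_plus_intro)
  then have W0: "0 \<in> W" by simp
  have WU: "W \<subseteq> interior U" using W_diff[OF _ W0] by auto
  have Ws: "W \<in> sets nu" using W_open W_right by (rule open_sets_nu)
  have "emeasure nu W \<le> emeasure nu (interior U)" using WU dp.sets_U by (rule emeasure_mono)
  then have W_fin: "emeasure nu W < \<infinity>" using finite_interior_U by simp
  define c where "c = measure nu W"
  have c: "0 < c"
    using emeasure_nu_pos[OF W_open W_right] W0 W_fin emeasure_eq_ennreal_measure[of nu W]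
    unfolding c_def by (auto simp: less_le)
  define T where "T x = (\<lambda>y. x + y) ` W" for x
  have Ts: "T x \<in> sets nu" for x unfolding T_def using Ws by (rule sets_image_translate)
  have T_fin: "emeasure nu (T x) < \<infinity>" for x unfolding T_def using emeasure_image_translate[OF Ws] W_fin by simp
  have T_T: "(\<lambda>y. s + y) ` T x = T (s + x)" for s x by (auto simp: T_def image_image add.assoc)
  have T0: "T 0 = W" by (simp add: T_def)
  have T_K: "T k = W" if "k \<in> K" for k
  proof (intro equalityI subsetI)
    fix w assume "w \<in> W"
    then have "k + (- k + w) \<in> T k" unfolding T_def using W_left[OF K_minus[OF that]] by blast
    then show "w \<in> T k" by (simp add: add.assoc[symmetric])
  qed (use W_left[OF that] in \<open>auto simp: T_def\<close>)
  have T_fm: "T x \<in> fmeasurable nu" for x using Ts T_fin by (auto simp: fmeasurable_def)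
  define g where "g x = measure nu (W \<inter> T x)" for x
  have g_eq: "g (- s + t) = measure nu (T s \<inter> T t)" for s t
  proof -
    have "T s \<inter> T t = (\<lambda>y. s + y) ` (W \<inter> T (- s + t))"
    proof -
      have "(\<lambda>y. s + y) ` (W \<inter> T (- s + t)) = (\<lambda>y. s + y) ` T 0 \<inter> (\<lambda>y. s + y) ` T (- s + t)"
        unfolding T0 by (rule image_Int) (simp add: inj_on_def)
      then show ?thesis by (simp only: T_T add_0_right add.assoc[symmetric] right_minus add_0_left)
    qed
    then show ?thesis unfolding g_def using measure_image_translate[OF sets.Int[OF Ws Ts]] by simp
  qed
  have ind_int: "integrable nu (\<lambda>x. indicator (T s) x * indicator (T t) x :: real)" for s t
  proof -
    have "integrable nu (indicator (T s \<inter> T t) :: 'g \<Rightarrow> real)"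
      using fmeasurable_Int_fmeasurable[OF T_fm[of s] Ts[of t]] by (auto simp: integrable_indicator_iff fmeasurable_def)
    then show ?thesis by (simp add: indicator_inter_arith[abs_def])
  qed
  have ind_val: "(\<integral>x. indicator (T s) x * indicator (T t) x \<partial>nu) = g (- s + t)" for s t
    unfolding g_eq indicator_inter_arith[symmetric] by (simp add: space_nu)
  have "pos_def g"
    unfolding pos_def_def
  proof safe
    fix x
    show "g (- x) = g x" using g_eq[of x 0] g_eq[of 0 x] by (simp add: Int_commute)
  next
    fix xs
    have "gram g xs xs = wsum xs (\<lambda>s. wsum xs (\<lambda>t. \<integral>x. indicator (T s) x * indicator (T t) x \<partial>nu))"
      by (simp add: gram_def ind_val)
    also have "\<dots> = (\<integral>x. wsum xs (\<lambda>s. wsum xs (\<lambda>t. indicator (T s) x * indicator (T t) x)) \<partial>nu)"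
      using ind_int by (simp add: integral_wsum integrable_wsum)
    also have "\<dots> = (\<integral>x. (wsum xs (\<lambda>s. indicator (T s) x))\<^sup>2 \<partial>nu)"
    proof (rule Bochner_Integration.integral_cong[OF refl])
      fix x
      show "wsum xs (\<lambda>s. wsum xs (\<lambda>t. indicator (T s) x * indicator (T t) x)) = (wsum xs (\<lambda>s. indicator (T s) x))\<^sup>2"
        by (simp add: wsum_mult wsum_mult[of xs "wsum xs (\<lambda>s. indicator (T s) x)", symmetric] power2_eq_square mult.commute)
    qed
    also have "0 \<le> \<dots>" by (rule integral_nonneg_AE) simp
    finally show "0 \<le> gram g xs xs" .
  qed
  \<comment> \<open>\<open>T y\<close> is covered by \<open>T x\<close> and
    \<open>T y - T x\<close>; translating the latter back by \<open>x\<close> gives the form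
    controlled by \<open>translate_continuous\<close>.\<close>
  have g_le: "g y \<le> g x + measure nu ((\<lambda>z. (- x + y) + z) ` W - W)" for x y
  proof -
    have fm: "W \<inter> T x \<in> fmeasurable nu" "T y - T x \<in> fmeasurable nu" for x y
      using T_fm Ts Ws by (auto intro: fmeasurable_Int_fmeasurable fmeasurable_Diff simp: Int_commute[of W])
    have "g y \<le> measure nu ((W \<inter> T x) \<union> (T y - T x))"
      unfolding g_def using fm Ws Ts by (intro measure_mono_fmeasurable fmeasurable.Un) auto
    also have "\<dots> \<le> g x + measure nu (T y - T x)"
      unfolding g_def using fm by (intro measure_Un_le) (auto dest: fmeasurableD)
    also have "T y - T x = (\<lambda>z. x + z) ` (T (- x + y) - T 0)"
    proof -
      have "(\<lambda>z. x + z) ` (T (- x + y) - T 0) = (\<lambda>z. x + z) ` T (- x + y) - (\<lambda>z. x + z) ` T 0"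
        by (rule image_set_diff) (simp add: inj_def)
      then show ?thesis by (simp only: T_T add_0_right add.assoc[symmetric] right_minus add_0_left)
    qed
    also have "measure nu \<dots> = measure nu (T (- x + y) - T 0)" using Ts by (intro measure_image_translate) auto
    finally show ?thesis by (simp add: T0) (simp add: T_def)
  qed
  have g_cont: "continuous_on UNIV g"
  proof (subst continuous_on_def, intro ballI tendstoI)
    fix x and e :: real assume "e > 0"
    obtain M where M: "open M" "0 \<in> M" "\<And>s. s \<in> M \<Longrightarrow> measure nu ((\<lambda>z. s + z) ` W - W) < e"
      by (rule translate_continuous[OF W_open W_right W_fin \<open>e > 0\<close>]) (rule that)
    \<comment> \<open>Both differences of \<open>x\<close> and \<open>y\<close> must be small, since
      \<open>g_le\<close> is one-sided and is used in both directions.\<close>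
    define M' where "M' = (\<lambda>y. - x + y) -` M \<inter> (\<lambda>y. - y + x) -` M"
    have "open M'" unfolding M'_def using M(1) by (intro open_Int open_vimage continuous_intros)
    moreover have "x \<in> M'" using M(2) by (simp add: M'_def)
    moreover have "dist (g y) (g x) < e" if "y \<in> M'" for y
      using M(3)[of "- x + y"] M(3)[of "- y + x"] g_le[of x y] g_le[of y x] that
      by (simp add: M'_def dist_real_def)
    ultimately show "\<forall>\<^sub>F y in at x within UNIV. dist (g y) (g x) < e"
      unfolding eventually_at_topological by blast
  qed
  have g0: "g 0 = c" by (simp add: g_def T0 c_def)
  have g_nonneg: "0 \<le> g x" for x by (simp add: g_def)
  have g_K: "g (x + k) = g x" if "k \<in> K" for x k
  proof -
    have "T (x + k) = T x" using T_T[of x k] T_T[of x 0] T_K[OF that] T0 by simp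
    then show ?thesis by (simp add: g_def)
  qed
  have g_U: "x \<in> interior U" if "0 < g x" for x
  proof -
    have "W \<inter> T x \<noteq> {}"
    proof
      assume "W \<inter> T x = {}"
      then have "g x = 0" by (simp add: g_def)
      with that show False by simp
    qed
    then obtain w where w: "w \<in> W" "x + w \<in> W" by (auto simp: T_def)
    have "x + w + - w \<in> interior U" using W_diff[OF w(2,1)] .
    then show ?thesis by (simp add: add.assoc)
  qed
  define f where "f x = inverse c * g x" for x
  have f: "f \<in> dp.adm"
    unfolding dp.adm_def
  proof (intro CollectI conjI)
    show "pos_def f" unfolding f_def using c \<open>pos_def g\<close> by (intro pos_def_scale) auto
    show "continuous_on UNIV f" unfolding f_def by (intro continuous_intros g_cont)
    show "\<forall>x. 0 < f x \<longrightarrow> x \<in> U"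
      using g_U interior_subset[of U] c by (auto simp: f_def zero_less_mult_iff)
    show "\<forall>x. f x < 0 \<longrightarrow> x \<in> V"
      using g_nonneg c by (simp add: f_def mult_less_0_iff not_less[symmetric])
  qed (use g0 g_K c in \<open>auto simp: f_def\<close>)
  have f_nonneg: "0 \<le> f x" for x using c g_nonneg by (simp add: f_def)
  have f_int: "integrable nu f"
  proof (rule Bochner_Integration.integrable_bound[OF dp.integrable_u])
    show "AE x in nu. norm (f x) \<le> norm (dp.u x)"
      using dp.adm_le_u[OF f] f_nonneg by (auto intro!: always_eventually)
  qed (rule dp.adm_measurable[OF f])
  \<comment> \<open>If the integral were 0, \<open>f\<close> would vanish almost everywhere,
    although it is nonzero on an open invariant set containing 0.\<close>
  have "(\<integral>x. f x \<partial>nu) \<noteq> 0"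
  proof
    assume "(\<integral>x. f x \<partial>nu) = 0"
    then have ae: "AE x in nu. f x = 0"
      using integral_nonneg_eq_0_iff_AE[OF f_int] f_nonneg by auto
    define A where "A = {x. f x \<noteq> 0}"
    have "open A" unfolding A_def using f by (intro open_Collect_neq) (auto simp: dp.adm_def)
    moreover have "right_invariant K A" using f by (auto simp: A_def right_invariant_def dp.adm_def)
    moreover have "0 \<in> A" using f by (simp add: A_def dp.adm_def)
    ultimately have "emeasure nu A \<noteq> 0" "A \<in> sets nu" using emeasure_nu_pos open_sets_nu by auto
    moreover have "emeasure nu A = 0"
      using AE_iff_measurable[OF \<open>A \<in> sets nu\<close>, of "\<lambda>x. f x = 0"] ae by (simp add: A_def space_nu)
    ultimately show False by simp
  qed
  moreover have "0 \<le> (\<integral>x. f x \<partial>nu)" using f_nonneg by (intro integral_nonneg_AE) simp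
  ultimately have "0 < (\<integral>x. f x \<partial>nu)" by simp
  with f f_int show ?thesis by (rule that)
qed

section \<open>Passage between kernels and functions\<close>

lemma kernel_in_adm:
  assumes Phi: "\<Phi> \<in> delsarte_class K U V"
  shows "(\<lambda>x. \<Phi> K (x +o K)) \<in> dp.adm"
proof -
  define f where "f x = \<Phi> K (x +o K)" for x
  have cont: "continuous_kernel K \<Phi>" and pd: "positive_definite_kernel K (\<lambda>p q. complex_of_real (\<Phi> p q))"
    and inv: "\<And>g x y. \<Phi> ((g + x) +o K) ((g + y) +o K) = \<Phi> (x +o K) (y +o K)"
    and one: "\<And>g. \<Phi> (g +o K) (g +o K) = 1"
    and supp: "kernel_support K (\<lambda>p q. max (\<Phi> p q) 0) \<subseteq> U" "kernel_support K (\<lambda>p q. max (- \<Phi> p q) 0) \<subseteq> V"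
    using Phi by (auto simp: delsarte_class_def invariant_kernel_def)
  have f_eq: "\<Phi> (x +o K) (y +o K) = f (- x + y)" for x y
    using inv[of "- x" x y] by (simp add: f_def coset_0)
  have pd': "(\<Sum>i<n. \<Sum>j<n. complex_of_real (f (- x i + x j)) * a i * cnj (a j)) \<in> \<real>\<^sub>\<ge>\<^sub>0"
    for n :: nat and x :: "nat \<Rightarrow> 'g" and a
    using pd unfolding positive_definite_kernel_def f_eq by blast
  have "pos_def f"
    unfolding pos_def_def
  proof safe
    fix y
    \<comment> \<open>The points 0 and \<open>y\<close> with weights 1 and \<open>\<i>\<close> give
      a sum with imaginary part \<open>f (- y) - f y\<close>, which must be 0.\<close>
    show "f (- y) = f y"
      using pd'[of "\<lambda>i. if i = 0 then 0 else y" "\<lambda>i. if i = 0 then 1 else \<i>" 2]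
      by (simp add: numeral_2_eq_2 complex_nonneg_Reals_iff)
  next
    fix xs :: "('g \<times> real) list"
    define x where "x i = fst (xs ! i)" for i
    define b where "b i = snd (xs ! i)" for i
    have xs: "xs = map (\<lambda>i. (x i, b i)) [0..<length xs]" by (simp add: x_def b_def map_nth)
    have "gram f xs xs = (\<Sum>i<length xs. b i * (\<Sum>j<length xs. b j * f (- x i + x j)))"
      unfolding gram_def by (subst (1 2) xs) (simp add: wsum_upt)
    then have "complex_of_real (gram f xs xs)
        = (\<Sum>i<length xs. \<Sum>j<length xs. complex_of_real (f (- x i + x j)) * complex_of_real (b i) * cnj (complex_of_real (b j)))"
      by (simp add: sum_distrib_left mult_ac)
    then have "complex_of_real (gram f xs xs) \<in> \<real>\<^sub>\<ge>\<^sub>0" by (simp only: pd')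
    then show "0 \<le> gram f xs xs" by simp
  qed
  moreover have "continuous_on UNIV f"
  proof -
    have "continuous_map euclidean (prod_topology (coset_topology K) (coset_topology K)) (\<lambda>x. (K, x +o K))"
      unfolding continuous_map_pairwise o_def fst_conv snd_conv
      using continuous_map_coset coset_in[of 0] by (simp add: topspace_coset_topology coset_0)
    from continuous_map_compose[OF this cont[unfolded continuous_kernel_def]]
    show ?thesis by (simp add: o_def f_def)
  qed
  moreover have "f 0 = 1" using one[of 0] by (simp add: f_def coset_0)
  moreover have "f (x + k) = f x" if "k \<in> K" for x k using that by (simp add: f_def coset_absorb)
  moreover have "x \<in> U" if "0 < f x" for x
  proof -
    have "x \<in> closure {x. max (\<Phi> K (x +o K)) 0 \<noteq> 0}"
      using that by (intro subsetD[OF closure_subset]) (simp add: f_def)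
    then show ?thesis by (rule subsetD[OF supp(1)[unfolded kernel_support_def]])
  qed
  moreover have "x \<in> V" if "f x < 0" for x
  proof -
    have "x \<in> closure {x. max (- \<Phi> K (x +o K)) 0 \<noteq> 0}"
      using that by (intro subsetD[OF closure_subset]) (simp add: f_def)
    then show ?thesis by (rule subsetD[OF supp(2)[unfolded kernel_support_def]])
  qed
  ultimately have "f \<in> dp.adm" by (simp add: dp.adm_def)
  then show ?thesis by (simp add: f_def[abs_def])
qed

text \<open>Evenness turns right K-invariance of \<open>h\<close> into left K-invariance, so
  \<open>h (- rep p + rep q)\<close> does not depend on the representatives.\<close>

lemma adm_to_kernel:
  assumes h: "h \<in> dp.adm"
  obtains \<Phi> where "\<Phi> \<in> delsarte_class K U V" "\<And>x. \<Phi> K (x +o K) = h x"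
proof -
  define \<Phi> where "\<Phi> p q = h (- rep p + rep q)" for p q
  have pd: "pos_def h" and cont: "continuous_on UNIV h" and h0: "h 0 = 1"
    and right: "\<And>x k. k \<in> K \<Longrightarrow> h (x + k) = h x"
    and signs: "\<And>x. 0 < h x \<Longrightarrow> x \<in> U" "\<And>x. h x < 0 \<Longrightarrow> x \<in> V"
    using h by (auto simp: dp.adm_def)
  have sym: "h (- x) = h x" for x using pd by (simp add: pos_def_def)
  have left: "h (k + x) = h x" if "k \<in> K" for x k
    using right[OF K_minus[OF that], of "- x"] sym[of "k + x"] sym[of x] by (simp add: minus_add)
  have Phi: "\<Phi> (x +o K) (y +o K) = h (- x + y)" for x y
  proof -
    obtain k where k: "k \<in> K" "rep (x +o K) = x + k" by (rule rep_eq)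
    obtain l where l: "l \<in> K" "rep (y +o K) = y + l" by (rule rep_eq)
    have "\<Phi> (x +o K) (y +o K) = h (- k + ((- x + y) + l))"
      unfolding \<Phi>_def k(2) l(2) by (simp only: minus_add add.assoc)
    then show ?thesis by (simp only: left[OF K_minus[OF k(1)]] right[OF l(1)])
  qed
  have Phi_K: "\<Phi> K (x +o K) = h x" for x using Phi[of 0 x] by (simp add: coset_0)
  have "continuous_kernel K \<Phi>"
    unfolding continuous_kernel_def continuous_map_def
  proof (intro conjI allI impI)
    fix T :: "real set" assume "openin euclideanreal T"
    then have T: "open T" by simp
    define S where "S = {p \<in> topspace (prod_topology (coset_topology K) (coset_topology K)). (case p of (p, q) \<Rightarrow> \<Phi> p q) \<in> T}"
    \<comment> \<open>Products of open sets of the group map to open boxes because the coset map is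
      open. Its being a quotient map would not be enough, as products of quotient maps need not be
      quotient maps.\<close>
    have "\<exists>A B. openin (coset_topology K) A \<and> openin (coset_topology K) B \<and> p \<in> A \<and> q \<in> B \<and> A \<times> B \<subseteq> S"
      if pq: "(p, q) \<in> S" for p q
    proof -
      obtain x y where xy: "p = x +o K" "q = y +o K"
        using pq by (auto simp: S_def topspace_coset_topology cosets_def)
      have "open ((\<lambda>z::'g \<times> 'g. h (- fst z + snd z)) -` T)"
        using T by (intro open_vimage continuous_on_compose2[OF cont] continuous_intros) auto
      moreover have "(x, y) \<in> (\<lambda>z. h (- fst z + snd z)) -` T" using pq by (simp add: S_def xy Phi)
      ultimately obtain A B where AB: "open A" "open B" "(x, y) \<in> A \<times> B" "A \<times> B \<subseteq> (\<lambda>z. h (- fst z + snd z)) -` T"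
        by (rule open_prod_elim)
      have "(\<lambda>x. x +o K) ` A \<times> (\<lambda>x. x +o K) ` B \<subseteq> S"
        using AB(4) by (auto simp: S_def topspace_coset_topology coset_in Phi)
      then show ?thesis using open_image_coset[OF AB(1)] open_image_coset[OF AB(2)] AB(3) unfolding xy by blast
    qed
    then show "openin (prod_topology (coset_topology K) (coset_topology K)) S"
      unfolding openin_prod_topology_alt by blast
  qed auto
  moreover have "positive_definite_kernel K (\<lambda>p q. complex_of_real (\<Phi> p q))"
    unfolding positive_definite_kernel_def
  proof (intro allI)
    fix n :: nat and x :: "nat \<Rightarrow> 'g" and a :: "nat \<Rightarrow> complex"
    define H where "H i j = h (- x i + x j)" for i j
    have H: "H i j = H j i" for i j unfolding H_def using sym[of "- x i + x j"] by (simp add: minus_add)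
    define z where "z = (\<Sum>i<n. \<Sum>j<n. complex_of_real (\<Phi> (x i +o K) (x j +o K)) * a i * cnj (a j))"
    have z: "z = (\<Sum>i<n. \<Sum>j<n. complex_of_real (H i j) * a i * cnj (a j))" by (simp add: z_def Phi H_def)
    have g: "0 \<le> (\<Sum>i<n. \<Sum>j<n. H i j * b i * b j)" for b
    proof -
      have "gram h (map (\<lambda>i. (x i, b i)) [0..<n]) (map (\<lambda>i. (x i, b i)) [0..<n]) = (\<Sum>i<n. \<Sum>j<n. H i j * b i * b j)"
        unfolding gram_def wsum_upt by (simp add: sum_distrib_left H_def mult_ac)
      then show ?thesis using pd unfolding pos_def_def by metis
    qed
    \<comment> \<open>For a real symmetric \<open>H\<close> the form at complex weights is the sum
      of its values at their real and imaginary parts; the mixed terms, which make up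
      \<open>Im z\<close>, cancel by symmetry.\<close>
    have "Re z = (\<Sum>i<n. \<Sum>j<n. H i j * Re (a i) * Re (a j)) + (\<Sum>i<n. \<Sum>j<n. H i j * Im (a i) * Im (a j))"
      unfolding z by (simp add: sum.distrib[symmetric] algebra_simps)
    then have "0 \<le> Re z" using g[of "\<lambda>i. Re (a i)"] g[of "\<lambda>i. Im (a i)"] by simp
    moreover have "Im z = 0"
    proof -
      have "Im z = (\<Sum>i<n. \<Sum>j<n. H i j * Im (a i) * Re (a j)) - (\<Sum>i<n. \<Sum>j<n. H i j * Re (a i) * Im (a j))"
        unfolding z by (simp add: sum_subtractf[symmetric] algebra_simps)
      also have "(\<Sum>i<n. \<Sum>j<n. H i j * Re (a i) * Im (a j)) = (\<Sum>j<n. \<Sum>i<n. H i j * Re (a i) * Im (a j))"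
        by (rule sum.swap)
      also have "\<dots> = (\<Sum>i<n. \<Sum>j<n. H i j * Im (a i) * Re (a j))"
        by (intro sum.cong refl) (simp add: H mult_ac)
      finally show ?thesis by simp
    qed
    ultimately show "z \<in> \<real>\<^sub>\<ge>\<^sub>0" by (simp add: complex_nonneg_Reals_iff)
  qed
  moreover have "invariant_kernel K \<Phi>"
    unfolding invariant_kernel_def Phi by (simp only: minus_add add.assoc minus_add_cancel) simp
  moreover have "\<Phi> (g +o K) (g +o K) = 1" for g by (simp add: Phi h0)
  moreover have "kernel_support K (\<lambda>p q. max (\<Phi> p q) 0) \<subseteq> U"
    unfolding kernel_support_def Phi_K using signs(1) U(1)
    by (intro closure_minimal) (auto simp: max_def split: if_splits)
  moreover have "kernel_support K (\<lambda>p q. max (- \<Phi> p q) 0) \<subseteq> V"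
    unfolding kernel_support_def Phi_K using signs(2) V
    by (intro closure_minimal) (auto simp: max_def split: if_splits)
  ultimately have "\<Phi> \<in> delsarte_class K U V" by (simp add: delsarte_class_def)
  then show ?thesis using Phi_K by (rule that)
qed

lemma extended_integral_kernel:
  assumes "(\<lambda>x. \<Phi> K (x +o K)) \<in> dp.adm"
  shows "extended_integral mu (\<lambda>q. \<Phi> K q) = extended_integral nu (\<lambda>x. \<Phi> K (x +o K))"
proof -
  have m: "(\<lambda>x. \<Phi> K (x +o K)) \<in> borel_measurable nu" using assms by (rule dp.adm_measurable)
  have "(\<integral>\<^sup>+x. ennreal (c * \<Phi> K (x +o K)) \<partial>nu) = (\<integral>\<^sup>+p. ennreal (c * \<Phi> K p) \<partial>mu)" for c
  proof -
    have "(\<integral>\<^sup>+x. ennreal (c * \<Phi> K (x +o K)) \<partial>distr mu nu rep) = (\<integral>\<^sup>+p. ennreal (c * \<Phi> K (rep p +o K)) \<partial>mu)"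
      using m by (intro nn_integral_distr rep_measurable) auto
    also have "\<dots> = (\<integral>\<^sup>+p. ennreal (c * \<Phi> K p) \<partial>mu)"
      by (rule nn_integral_cong) (simp add: space_mu rep_coset')
    finally show ?thesis by (simp only: nu_distr[symmetric])
  qed
  \<comment> \<open>The factor \<open>c\<close> treats the positive part (1) and the negative part
    (-1) of the kernel together.\<close>
  from this[of 1] this[of "- 1"] show ?thesis by (simp add: extended_integral_def)
qed

text \<open>The majorant \<open>u\<close> makes the positive part finite, so integrability can fail
  only through an infinite negative part, which gives -\<infinity>.\<close>

lemma extended_integral_adm:
  assumes f: "f \<in> dp.adm"
  shows "extended_integral nu f = (if integrable nu f then ereal (\<integral>x. f x \<partial>nu) else - \<infinity>)"
proof -
  have m [measurable]: "f \<in> borel_measurable nu" using f by (rule dp.adm_measurable)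
  have "(\<integral>\<^sup>+x. ennreal (f x) \<partial>nu) \<le> (\<integral>\<^sup>+x. indicator (interior U) x \<partial>nu)"
    by (subst ennreal_indicator[symmetric]) (intro nn_integral_mono ennreal_leI dp.adm_le_u[OF f])
  also have "\<dots> < \<infinity>" using finite_interior_U dp.sets_U by simp
  finally have pos: "(\<integral>\<^sup>+x. ennreal (f x) \<partial>nu) < \<infinity>" .
  show ?thesis
  proof (cases "integrable nu f")
    case True
    then have neg: "(\<integral>\<^sup>+x. ennreal (- f x) \<partial>nu) < \<infinity>" by (simp add: real_integrable_def less_top)
    have e: "enn2ereal y = ereal (enn2real y)" if "y < \<infinity>" for y
      using that by (cases y) (auto simp: enn2ereal_ennreal)
    show ?thesis using True
      by (simp add: extended_integral_def e[OF pos] e[OF neg] real_lebesgue_integral_def)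
  next
    case False
    then have "(\<integral>\<^sup>+x. ennreal (- f x) \<partial>nu) = \<infinity>" using pos m by (auto simp: real_integrable_def)
    then show ?thesis using False pos by (cases "\<integral>\<^sup>+x. ennreal (f x) \<partial>nu") (auto simp: extended_integral_def enn2ereal_ennreal)
  qed
qed

lemma delsarte_extremal_exists:
  "\<exists>\<Phi>\<in>delsarte_class K U V. extended_integral mu (\<lambda>q. \<Phi> K q) = delsarte_constant mu K U V"
proof -
  obtain f0 where f0: "f0 \<in> dp.adm" "integrable nu f0" "0 < (\<integral>x. f0 x \<partial>nu)"
    by (rule adm_positive_integral)
  obtain h where h: "h \<in> dp.adm" "integrable nu h"
    "\<And>f. f \<in> dp.adm \<Longrightarrow> integrable nu f \<Longrightarrow> (\<integral>x. f x \<partial>nu) \<le> (\<integral>x. h x \<partial>nu)"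
    by (rule dp.maximiser_exists[OF f0]) blast
  obtain \<Phi> where Phi: "\<Phi> \<in> delsarte_class K U V" "\<And>x. \<Phi> K (x +o K) = h x"
    by (rule adm_to_kernel[OF h(1)]) blast
  have ext: "extended_integral mu (\<lambda>q. \<Psi> K q) = extended_integral nu (\<lambda>x. \<Psi> K (x +o K))"
    if "\<Psi> \<in> delsarte_class K U V" for \<Psi>
    using that by (intro extended_integral_kernel kernel_in_adm)
  have val: "extended_integral mu (\<lambda>q. \<Phi> K q) = ereal (\<integral>x. h x \<partial>nu)"
    using ext[OF Phi(1)] extended_integral_adm[OF h(1)] h(2) by (simp add: Phi(2))
  have "extended_integral mu (\<lambda>q. \<Psi> K q) \<le> ereal (\<integral>x. h x \<partial>nu)" if "\<Psi> \<in> delsarte_class K U V" for \<Psi>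
    using ext[OF that] extended_integral_adm[OF kernel_in_adm[OF that]] h(3)[OF kernel_in_adm[OF that]] by simp
  then have "delsarte_constant mu K U V = extended_integral mu (\<lambda>q. \<Phi> K q)"
    unfolding delsarte_constant_def val
    by (intro antisym SUP_least SUP_upper2[OF Phi(1)]) (auto simp: val)
  then show ?thesis using Phi(1) by auto
qed

end

theorem theorem18:
  fixes K U V :: "'g::{topological_group_add, t2_space} set"
    and lamG lamK :: "'g measure"
    and mu :: "'g set measure"
  assumes "locally_compact_space (euclidean :: 'g topology)"
    and "left_haar_measure UNIV lamG"
    and "amenable lamG"
    and "is_subgroup K" and "compact K"
    and "left_haar_measure K lamK" and "emeasure lamK K = 1"
    and "normalised_quotient_measure K lamG lamK mu"
    and "closed U" and "bi_invariant K U" and "symmetric_set U"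
    and "0 \<in> interior U" and "emeasure lamG U < \<infinity>"
    and "closed V" and "bi_invariant K V" and "symmetric_set V"
  shows "\<exists>\<Phi>\<in>delsarte_class K U V.
           extended_integral mu (\<lambda>q. \<Phi> K q) = delsarte_constant mu K U V"
proof -
  interpret delsarte_data K lamG lamK mu U V
    using assms by unfold_locales
  show ?thesis by (rule delsarte_extremal_exists)
qed

end
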